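(* Let $t\in(0,1)$ and let $(Z_1,\dots,Z_p)^T\sim N((\mu_1,\dots,\mu_p)^T,\boldsymbol\Sigma)$ with $\boldsymbol\Sigma=(\sigma_{ij})$ and $\sigma_{jj}=1$ for $j=1,\dots,p$. Let $(i,j)$, $i\neq j$, be an index pair with $\sigma_{ij}\neq0$. Then: (a) if $i,j\in\mathcal H_0$, then $\mathrm{Cov}(t_i,t_j)>0$; (b) if $i\in\mathcal H_0$ and $j\in\mathcal H_1$, then $\mathrm{Cov}(t_i,t_j)<0$ provided $|\mu_j|>2|z_{t/2}|$ and $t<2\{1-\Phi(\sqrt{\log(3)/2})\}$; (c) if $i,j\in\mathcal H_1$, then $\mathrm{Cov}(t_i,t_j)>0$ provided $|\sigma_{ij}|\le|\mu|_{\min}/(|\mu|_{\max}+z_{t/2})$ and $\mathrm{sign}(\sigma_{ij})=\mathrm{sign}(\mu_i\mu_j)$, where $|\mu|_{\min}=\min(|\mu_i|,|\mu_j|)$ and $|\mu|_{\max}=\max(|\mu_i|,|\mu_j|)$.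
   Context: $\Phi$ is the standard normal distribution function and $z_{t/2}=\Phi^{-1}(t/2)$ is the $(t/2)$-quantile (so $z_{t/2}<0$). $\mathcal H_0=\{j:\mu_j=0\}$, $\mathcal H_1=\{j:\mu_j\neq0\}$. The $j$th test is $t_j=\mathbf 1(|Z_j|>|z_{t/2}|)$. *)

theory Defs
  imports "HOL-Probability.Probability"
begin

definition Phi :: "real \<Rightarrow> real" where
  "Phi = cdf std_normal_distribution"

(* Phi is a bijection from the reals onto {0<..<1}, so its inverse is meaningful
   only at levels u in {0<..<1}. *)
definition std_normal_quantile :: "real \<Rightarrow> real" where
  "std_normal_quantile u = inv Phi u"

definition std_normal_vector :: "(real ^ 'n) measure" where
  "std_normal_vector = density lborel (\<lambda>x. ennreal (\<Prod>k\<in>UNIV. std_normal_density (x $ k)))"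

(* Z ~ N(m, S) in the general, possibly degenerate, sense: Z has the law of m + A X, where
   X has independent standard normal coordinates and A A^T = S. A density for Z is not
   required, so S may be singular. The factorisation makes S symmetric and positive
   semidefinite, and every such S has a square factor A, so square matrices suffice. *)
definition multivariate_normal ::
  "'a measure \<Rightarrow> ('a \<Rightarrow> real ^ 'n) \<Rightarrow> real ^ 'n \<Rightarrow> real ^ 'n ^ 'n \<Rightarrow> bool" where
  "multivariate_normal M Z m S \<longleftrightarrow>
     prob_space M \<and> Z \<in> borel_measurable M \<and>
     (\<exists>A :: real ^ 'n ^ 'n. A ** transpose A = S \<and>
        distr M borel Z = distr std_normal_vector borel (\<lambda>x. m + A *v x))"

definition covariance :: "'a measure \<Rightarrow> ('a \<Rightarrow> real) \<Rightarrow> ('a \<Rightarrow> real) \<Rightarrow> real" where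
  "covariance M X Y =
     (\<integral>\<omega>. (X \<omega> - (\<integral>\<omega>'. X \<omega>' \<partial>M)) * (Y \<omega> - (\<integral>\<omega>'. Y \<omega>' \<partial>M)) \<partial>M)"

definition true_nulls :: "real ^ 'n \<Rightarrow> 'n set" where
  "true_nulls m = {j. m $ j = 0}"

definition false_nulls :: "real ^ 'n \<Rightarrow> 'n set" where
  "false_nulls m = {j. m $ j \<noteq> 0}"

definition two_sided_test :: "real \<Rightarrow> ('a \<Rightarrow> real ^ 'n) \<Rightarrow> 'n \<Rightarrow> 'a \<Rightarrow> real" where
  "two_sided_test t Z j \<omega> = of_bool (\<bar>Z \<omega> $ j\<bar> > \<bar>std_normal_quantile (t / 2)\<bar>)"

end

theory Submission
  imports Defs
begin

text \<open>
  The covariance of two tests equals that of the acceptance indicators, so it compares the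
  probability \<open>G r\<close> that a bivariate normal vector with correlation \<open>r\<close> lies in a square with
  \<open>G 0\<close>; flipping the signs of the two coordinates makes the correlation positive. By Plackett's
  identity \<open>G'\<close> is the alternating sum of the joint density over the corners of the square, which is
  a positive multiple of \<open>exp R * cosh (A + B) - exp (- R) * cosh (A - B)\<close> with
  \<open>A = c (a - r b) / (1 - r\<^sup>2)\<close>, \<open>B = c (b - r a) / (1 - r\<^sup>2)\<close>, \<open>R = r c\<^sup>2 / (1 - r\<^sup>2)\<close> for means
  \<open>a\<close>, \<open>b\<close> and half-width \<open>c\<close>. Under each of the three hypotheses this has a constant sign on the
  open interval from \<open>0\<close> to the actual correlation. Continuity of \<open>G\<close> up to \<open>1\<close> covers the
  degenerate case.
\<close>

section \<open>Convergence of measures of sets\<close>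

lemma (in finite_measure) abs_measure_diff_le:
  assumes A: "A \<in> sets M" and B: "B \<in> sets M" and D: "D \<in> sets M" and "sym_diff A B \<subseteq> D"
  shows "\<bar>measure M A - measure M B\<bar> \<le> measure M D"
proof -
  have "measure M A \<le> measure M (B \<union> D)" "measure M B \<le> measure M (A \<union> D)"
    using assms by (auto intro!: finite_measure_mono)
  moreover have "measure M (B \<union> D) \<le> measure M B + measure M D"
    using B D by (rule measure_Un_le)
  moreover have "measure M (A \<union> D) \<le> measure M A + measure M D"
    using A D by (rule measure_Un_le)
  ultimately show ?thesis by linarith
qed

lemma (in finite_measure) measure_decseq_tendsto_0:
  assumes D: "\<And>n :: nat. D n \<in> sets M" and "decseq D" and null: "AE x in M. x \<notin> (\<Inter>n. D n)"
  shows "(\<lambda>n. measure M (D n)) \<longlonglongrightarrow> 0"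
proof -
  have "(\<Inter>n. D n) \<in> sets M"
    using D by (intro sets.countable_INT) auto
  with null have "(\<Inter>n. D n) \<in> null_sets M"
    using AE_iff_null_sets by blast
  then have "measure M (\<Inter>n. D n) = 0"
    by (rule measure_eq_0_null_sets)
  moreover have "(\<lambda>n. measure M (D n)) \<longlonglongrightarrow> measure M (\<Inter>n. D n)"
    using D \<open>decseq D\<close> by (intro finite_Lim_measure_decseq) auto
  ultimately show ?thesis by simp
qed

text \<open>Continuity from above, applied to the tails of the symmetric differences.\<close>

lemma (in finite_measure) measure_tendsto_AE:
  assumes A: "\<And>n :: nat. A n \<in> sets M" and B: "B \<in> sets M"
    and lim: "AE x in M. eventually (\<lambda>n. x \<in> A n \<longleftrightarrow> x \<in> B) sequentially"
  shows "(\<lambda>n. measure M (A n)) \<longlonglongrightarrow> measure M B"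
proof -
  define D where "D n = (\<Union>m\<in>{n..}. sym_diff (A m) B)" for n
  have D: "D n \<in> sets M" for n
    unfolding D_def using A B by (intro sets.countable_UN'') auto
  have sub: "sym_diff (A n) B \<subseteq> D n" for n
    unfolding D_def by (rule UN_upper) simp
  have dec: "decseq D"
    unfolding decseq_def D_def by (intro allI impI UN_mono) auto
  have not_D: "x \<notin> (\<Inter>n. D n)" if "eventually (\<lambda>n. x \<in> A n \<longleftrightarrow> x \<in> B) sequentially" for x
    using that by (force simp: D_def eventually_sequentially)
  have "AE x in M. x \<notin> (\<Inter>n. D n)"
    by (rule AE_mp[OF lim]) (intro AE_I2 impI not_D)
  then have lim0: "(\<lambda>n. measure M (D n)) \<longlonglongrightarrow> 0"
    by (rule measure_decseq_tendsto_0[OF D dec])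
  show ?thesis
  proof (rule tendstoI)
    fix e :: real assume "0 < e"
    from order_tendstoD(2)[OF lim0 this]
    show "eventually (\<lambda>n. dist (measure M (A n)) (measure M B) < e) sequentially"
      unfolding dist_real_def
      by (rule eventually_mono) (rule le_less_trans[OF abs_measure_diff_le[OF A B D sub]])
  qed
qed

section \<open>Rotation invariance of the standard normal vector\<close>

text \<open>The image measure is translation invariant; comparing its product with Lebesgue measure on
  \<open>{(x, y). y \<in> ball 0 1 \<and> y + x \<in> A}\<close> identifies the two, because the unit ball is preserved.\<close>

lemma distr_lborel_orthogonal:
  fixes f :: "'a::euclidean_space \<Rightarrow> 'a"
  assumes f: "orthogonal_transformation f"
  shows "distr lborel borel f = lborel"
proof (rule measure_eqI)
  let ?\<mu> = "distr lborel borel f" and ?K = "ball (0::'a) 1"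
  have lin: "linear f" and nf: "norm (f x) = norm x" for x
    using f by (auto simp: orthogonal_transformation)
  have [measurable]: "f \<in> borel_measurable borel"
    using lin by (intro borel_measurable_continuous_onI linear_continuous_on)
      (simp add: linear_conv_bounded_linear)
  \<comment> \<open>Since \<open>f\<close> is onto, a shift by \<open>y\<close> after
    \<open>f\<close> is a shift by some \<open>d\<close> before \<open>f\<close>, and Lebesgue
    measure absorbs the latter.\<close>
  have trans: "distr ?\<mu> borel ((+) y) = ?\<mu>" for y
  proof -
    obtain d where d: "f d = y"
      using orthogonal_transformation_surj[OF f] by (metis surjD)
    have "distr ?\<mu> borel ((+) y) = distr lborel borel (\<lambda>x. f (d + x))"
      by (simp add: distr_distr o_def d linear_add[OF lin])
    also have "\<dots> = distr (distr lborel borel ((+) d)) borel f"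
      by (simp add: distr_distr o_def)
    finally show ?thesis by (simp add: lborel_distr_plus)
  qed
  \<comment> \<open>Translation invariance moves the ball to the origin, where it is its own
    preimage under the norm-preserving \<open>f\<close>.\<close>
  have K: "emeasure ?\<mu> (ball y 1) = emeasure lborel ?K" for y
  proof -
    have "emeasure ?\<mu> (ball y 1) = emeasure (distr ?\<mu> borel ((+) y)) (ball y 1)"
      by (simp add: trans)
    also have "\<dots> = emeasure ?\<mu> ?K"
      by (subst emeasure_distr) (auto intro!: arg_cong[of _ _ "emeasure ?\<mu>"] simp: dist_norm)
    also have "\<dots> = emeasure lborel ?K"
      by (subst emeasure_distr) (auto intro!: arg_cong[of _ _ "emeasure lborel"] simp: nf)
    finally show ?thesis .
  qed
  \<comment> \<open>Fubini requires sigma-finiteness; centred balls are preserved by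
    \<open>f\<close>, hence keep their finite mass and exhaust the space.\<close>
  interpret \<mu>: sigma_finite_measure ?\<mu>
  proof
    let ?A = "range (\<lambda>n. ball (0::'a) (real n))"
    have "emeasure ?\<mu> (ball 0 r) = emeasure lborel (ball (0::'a) r)" for r
      by (subst emeasure_distr) (auto intro!: arg_cong[of _ _ "emeasure lborel"] simp: nf)
    then show "\<exists>A. countable A \<and> A \<subseteq> sets ?\<mu> \<and> \<Union>A = space ?\<mu> \<and> (\<forall>a\<in>A. emeasure ?\<mu> a \<noteq> \<infinity>)"
      using emeasure_lborel_ball_finite[of "0::'a"]
      by (intro exI[of _ ?A]) (auto simp: less_top[symmetric] intro: reals_Archimedean2)
  qed
  interpret pair_sigma_finite ?\<mu> lborel ..
  fix A assume "A \<in> sets ?\<mu>"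
  then have [measurable]: "A \<in> sets borel" "?K \<in> sets borel" by simp_all
  have "emeasure ?\<mu> A * emeasure lborel ?K
      = (\<integral>\<^sup>+y. emeasure ?\<mu> A * indicator ?K y \<partial>lborel)"
    by (simp add: nn_integral_cmult_indicator)
  also have "\<dots> = (\<integral>\<^sup>+y. (\<integral>\<^sup>+x. indicator A (y + x) * indicator ?K y \<partial>?\<mu>) \<partial>lborel)"
  proof (rule nn_integral_cong)
    fix y
    have "emeasure ?\<mu> A = (\<integral>\<^sup>+x. indicator A x \<partial>(distr ?\<mu> borel ((+) y)))"
      by (simp add: trans)
    also have "\<dots> = (\<integral>\<^sup>+x. indicator A (y + x) \<partial>?\<mu>)"
      by (subst nn_integral_distr) auto
    finally show "emeasure ?\<mu> A * indicator ?K y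
        = (\<integral>\<^sup>+x. indicator A (y + x) * indicator ?K y \<partial>?\<mu>)"
      by (simp add: nn_integral_multc)
  qed
  also have "\<dots> = (\<integral>\<^sup>+x. (\<integral>\<^sup>+y. indicator A (y + x) * indicator ?K y \<partial>lborel) \<partial>?\<mu>)"
    by (subst Fubini') measurable
  also have "\<dots> = (\<integral>\<^sup>+x. (\<integral>\<^sup>+y. indicator A y * indicator ?K (y - x) \<partial>lborel) \<partial>?\<mu>)"
  proof (rule nn_integral_cong)
    fix x
    have "(\<integral>\<^sup>+y. indicator A y * indicator ?K (y - x) \<partial>lborel)
        = (\<integral>\<^sup>+y. indicator A y * indicator ?K (y - x) \<partial>distr lborel borel ((+) x))"
      by (simp add: lborel_distr_plus)
    also have "\<dots> = (\<integral>\<^sup>+y. indicator A (y + x) * indicator ?K y \<partial>lborel)"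
      by (subst nn_integral_distr) (auto simp: add.commute)
    finally show "(\<integral>\<^sup>+y. indicator A (y + x) * indicator ?K y \<partial>lborel)
        = (\<integral>\<^sup>+y. indicator A y * indicator ?K (y - x) \<partial>lborel :: ennreal)" by simp
  qed
  also have "\<dots> = (\<integral>\<^sup>+y. (\<integral>\<^sup>+x. indicator A y * indicator ?K (y - x) \<partial>?\<mu>) \<partial>lborel)"
    by (subst Fubini') measurable
  also have "\<dots> = (\<integral>\<^sup>+y. indicator A y * emeasure lborel ?K \<partial>lborel)"
  proof (rule nn_integral_cong)
    fix y
    have "(\<integral>\<^sup>+x. indicator A y * indicator ?K (y - x) \<partial>?\<mu>)
        = (\<integral>\<^sup>+x. indicator A y * indicator (ball y 1) x \<partial>?\<mu>)"
      by (intro nn_integral_cong) (auto simp: indicator_def dist_norm norm_minus_commute)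
    then show "(\<integral>\<^sup>+x. indicator A y * indicator ?K (y - x) \<partial>?\<mu>)
        = indicator A y * emeasure lborel ?K"
      using K[of y] by (simp add: nn_integral_cmult_indicator)
  qed
  also have "\<dots> = emeasure lborel A * emeasure lborel ?K"
    by (simp add: nn_integral_multc)
  finally have eq: "emeasure ?\<mu> A * emeasure lborel ?K = emeasure lborel A * emeasure lborel ?K" .
  \<comment> \<open>The unit ball has positive and finite volume, so it cancels from
    \<open>eq\<close>.\<close>
  have "emeasure lborel ?K \<noteq> 0"
    using content_ball_pos[of 1 "0::'a"] by (auto simp: measure_def)
  moreover have "emeasure lborel ?K \<noteq> \<infinity>"
    using emeasure_lborel_ball_finite[of "0::'a" 1] by simp
  ultimately show "emeasure ?\<mu> A = emeasure lborel A"
    using eq by (simp add: mult.commute[of _ "emeasure lborel ?K"] ennreal_mult_cancel_left)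
qed simp

text \<open>The density depends on \<open>x\<close> only through its norm; this is what makes the
  law invariant under orthogonal maps.\<close>

lemma prod_std_normal_density_vec:
  fixes x :: "real ^ 'n"
  shows "(\<Prod>k\<in>UNIV. std_normal_density (x $ k)) = (1 / sqrt (2 * pi)) ^ CARD('n) * exp (- (norm x)\<^sup>2 / 2)"
  by (simp add: std_normal_density_def prod.distrib prod_dividef power_one_over exp_sum[symmetric]
      norm_vec_def L2_set_def sum_nonneg sum_negf sum_divide_distrib)

lemma sets_std_normal_vector [simp, measurable_cong]: "sets std_normal_vector = sets borel"
  and space_std_normal_vector [simp]: "space std_normal_vector = UNIV"
  by (simp_all add: std_normal_vector_def)

lemma distr_std_normal_vector_orthogonal:
  fixes f :: "real ^ 'n \<Rightarrow> real ^ 'n"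
  assumes f: "orthogonal_transformation f"
  shows "distr std_normal_vector borel f = std_normal_vector"
proof (rule measure_eqI)
  let ?g = "\<lambda>x :: real ^ 'n. ennreal (\<Prod>k\<in>UNIV. std_normal_density (x $ k))"
  have lin: "linear f" and nf: "norm (f x) = norm x" for x
    using f by (auto simp: orthogonal_transformation)
  have [measurable]: "f \<in> borel_measurable borel"
    using lin by (intro borel_measurable_continuous_onI linear_continuous_on)
      (simp add: linear_conv_bounded_linear)
  have [measurable]: "?g \<in> borel_measurable borel"
    unfolding prod_std_normal_density_vec by measurable
  fix A assume "A \<in> sets (distr std_normal_vector borel f)"
  then have [measurable]: "A \<in> sets borel" by simp
  have "emeasure (distr std_normal_vector borel f) A = (\<integral>\<^sup>+x. indicator A (f x) \<partial>std_normal_vector)"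
    using nn_integral_distr[of f std_normal_vector borel "indicator A"] by simp
  also have "\<dots> = (\<integral>\<^sup>+x. ?g (f x) * indicator A (f x) \<partial>lborel)"
    unfolding std_normal_vector_def
    by (subst nn_integral_density) (auto simp: prod_std_normal_density_vec nf)
  also have "\<dots> = (\<integral>\<^sup>+x. ?g x * indicator A x \<partial>distr lborel borel f)"
    by (subst nn_integral_distr) auto
  also have "\<dots> = emeasure std_normal_vector A"
    by (simp add: distr_lborel_orthogonal[OF f] std_normal_vector_def emeasure_density)
  finally show "emeasure (distr std_normal_vector borel f) A = emeasure std_normal_vector A" .
qed simp

section \<open>Independence of the coordinates of the standard normal vector\<close>

lemma prob_space_std_normal: "prob_space std_normal_distribution"
  using real_dist_normal_dist by (simp add: real_distribution_def)

lemma emeasure_std_normal_vector_prod: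
  fixes A :: "'n::finite \<Rightarrow> real set"
  assumes [measurable]: "\<And>k. A k \<in> sets borel"
  shows "emeasure std_normal_vector {x :: real ^ 'n. \<forall>k. x $ k \<in> A k}
    = (\<Prod>k\<in>UNIV. emeasure std_normal_distribution (A k))"
proof -
  let ?h = "\<lambda>k y. ennreal (std_normal_density y) * indicator (A k) y"
  have [measurable]: "{x :: real ^ 'n. \<forall>k. x $ k \<in> A k} \<in> sets borel"
    by measurable
  have bas: "prod F (Basis :: (real ^ 'n) set) = (\<Prod>k\<in>UNIV. F (axis k 1))"
    for F :: "real ^ 'n \<Rightarrow> ennreal"
  proof -
    have "(Basis :: (real ^ 'n) set) = (\<lambda>k. axis k 1) ` UNIV"
      by (auto simp: Basis_vec_def)
    then show ?thesis
      using prod.reindex[of "\<lambda>k. axis k (1::real) :: real ^ 'n" UNIV F]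
      by (simp add: inj_on_def axis_eq_axis o_def)
  qed
  \<comment> \<open>Tonelli for \<open>lborel\<close> is stated over \<open>Basis\<close>;
    \<open>idx\<close> recovers the coordinate that belongs to a basis vector.\<close>
  define idx where "idx b = (THE k. b = axis k (1::real))" for b :: "real ^ 'n"
  have idx [simp]: "idx (axis k 1) = k" for k
    unfolding idx_def by (auto simp: axis_eq_axis)
  have "emeasure std_normal_vector {x :: real ^ 'n. \<forall>k. x $ k \<in> A k}
      = (\<integral>\<^sup>+x. (\<Prod>k\<in>UNIV. ?h k (x $ k)) \<partial>lborel)"
    unfolding std_normal_vector_def
    by (subst emeasure_density, measurable)
      (auto intro!: nn_integral_cong simp: prod_ennreal prod.distrib indicator_def split: if_splits)
  also have "\<dots> = (\<integral>\<^sup>+x. (\<Prod>b\<in>Basis. ?h (idx b) (x \<bullet> b)) \<partial>lborel)"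
    by (simp add: bas inner_axis)
  also have "\<dots> = (\<Prod>b\<in>(Basis :: (real ^ 'n) set). \<integral>\<^sup>+y. ?h (idx b) y \<partial>lborel)"
    by (intro nn_integral_lborel_prod) auto
  also have "\<dots> = (\<Prod>k\<in>UNIV. emeasure std_normal_distribution (A k))"
    by (simp add: bas emeasure_density)
  finally show ?thesis .
qed

lemma distr_std_normal_vector_pair:
  fixes i j :: "'n::finite"
  assumes "i \<noteq> j"
  shows "distr (std_normal_vector :: (real ^ 'n) measure) (borel \<Otimes>\<^sub>M borel) (\<lambda>x. (x $ i, x $ j))
    = std_normal_distribution \<Otimes>\<^sub>M std_normal_distribution"
proof -
  interpret N: prob_space std_normal_distribution by (rule prob_space_std_normal)
  have one: "emeasure std_normal_distribution UNIV = 1"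
    using N.emeasure_space_1 by simp
  show ?thesis
  proof (rule pair_measure_eqI[symmetric])
    fix A B assume "A \<in> sets std_normal_distribution" "B \<in> sets std_normal_distribution"
    then have [measurable]: "A \<in> sets borel" "B \<in> sets borel" by auto
    \<comment> \<open>The remaining coordinates are unconstrained and each contribute the factor
      \<open>1\<close>.\<close>
    let ?A = "\<lambda>k. if k = i then A else if k = j then B else UNIV"
    have "emeasure (distr (std_normal_vector :: (real ^ 'n) measure) (borel \<Otimes>\<^sub>M borel) (\<lambda>x. (x $ i, x $ j))) (A \<times> B)
        = emeasure std_normal_vector {x :: real ^ 'n. \<forall>k. x $ k \<in> ?A k}"
      using assms by (subst emeasure_distr) (auto intro!: arg_cong[of _ _ "emeasure std_normal_vector"] split: if_splits)
    also have "\<dots> = (\<Prod>k\<in>UNIV. emeasure std_normal_distribution (?A k))"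
      by (rule emeasure_std_normal_vector_prod) auto
    also have "\<dots> = (\<Prod>k\<in>{i, j}. emeasure std_normal_distribution (?A k))"
      by (rule prod.mono_neutral_right) (auto simp: one)
    also have "\<dots> = emeasure std_normal_distribution A * emeasure std_normal_distribution B"
      using assms by simp
    finally show "emeasure std_normal_distribution A * emeasure std_normal_distribution B =
      emeasure (distr (std_normal_vector :: (real ^ 'n) measure) (borel \<Otimes>\<^sub>M borel) (\<lambda>x. (x $ i, x $ j))) (A \<times> B)" ..
  qed (auto intro: N.sigma_finite_measure_axioms intro!: sets_pair_measure_cong)
qed

section \<open>Reflections, and the joint law of two inner products\<close>

lemma orthogonal_transformation_householder:
  fixes d :: "'a::real_inner"
  shows "orthogonal_transformation (\<lambda>x. x - (2 * (x \<bullet> d) / (d \<bullet> d)) *\<^sub>R d)"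
proof (cases "d = 0")
  case False
  then have "d \<bullet> d \<noteq> 0" by simp
  then show ?thesis
    unfolding orthogonal_transformation_def
    by (auto intro!: linearI simp: algebra_simps inner_simps add_divide_distrib inner_commute)
\<comment> \<open>For \<open>d = 0\<close> the formula gives the identity map.\<close>
qed (simp add: orthogonal_transformation_def linear_id[unfolded id_def])

text \<open>For equal norms, \<open>2 * (x \<bullet> (x - y))\<close> is the squared length of
  \<open>x - y\<close>, so exactly one copy of \<open>x - y\<close> is subtracted.\<close>

lemma householder_swap:
  fixes x y :: "'a::real_inner"
  assumes "norm x = norm y"
  shows "x - (2 * (x \<bullet> (x - y)) / ((x - y) \<bullet> (x - y))) *\<^sub>R (x - y) = y"
proof (cases "x = y")
  case False
  have "x \<bullet> x = y \<bullet> y" using assms by (simp add: norm_eq)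
  then have "2 * (x \<bullet> (x - y)) = (x - y) \<bullet> (x - y)"
    by (simp add: algebra_simps inner_commute)
  then show ?thesis using False by simp
qed simp

text \<open>Two reflections suffice: the first sends \<open>u\<close> to the axis \<open>i\<close>;
  the second keeps that axis and turns the part of the image of \<open>v\<close> orthogonal to it
  into the direction \<open>j\<close>. This includes parallel \<open>u\<close> and \<open>v\<close>,
  where the second component is zero.\<close>

lemma orthogonal_transformation_two_units:
  fixes u v :: "real ^ 'n" and i j :: 'n
  assumes u: "norm u = 1" and v: "norm v = 1" and "i \<noteq> j"
  obtains f :: "real ^ 'n \<Rightarrow> real ^ 'n" where "orthogonal_transformation f" "f u = axis i 1"
    "f v = (u \<bullet> v) *\<^sub>R axis i 1 + sqrt (1 - (u \<bullet> v)\<^sup>2) *\<^sub>R axis j 1"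
proof -
  define H :: "real ^ 'n \<Rightarrow> real ^ 'n \<Rightarrow> real ^ 'n"
    where "H d x = x - (2 * (x \<bullet> d) / (d \<bullet> d)) *\<^sub>R d" for d x
  have H: "orthogonal_transformation (H d)" for d
    unfolding H_def by (rule orthogonal_transformation_householder)
  have swap: "norm x = norm y \<Longrightarrow> H (x - y) x = y" for x y
    unfolding H_def by (rule householder_swap)
  have fix_orth: "x \<bullet> d = 0 \<Longrightarrow> H d x = x" for x d by (simp add: H_def)
  define r where "r = u \<bullet> v"
  define f where "f = H (u - axis i 1)"
  define w where "w = f v - r *\<^sub>R axis i 1"
  define y :: "real ^ 'n" where "y = sqrt (1 - r\<^sup>2) *\<^sub>R axis j 1"
  have of: "orthogonal_transformation f" unfolding f_def by (rule H)
  have fu: "f u = axis i 1"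
    unfolding f_def using u by (intro swap) simp
  have r: "axis i 1 \<bullet> f v = r"
    using of fu unfolding orthogonal_transformation_def r_def by metis
  have fv1: "f v \<bullet> f v = 1"
    using of v unfolding orthogonal_transformation_def by (simp add: norm_eq_1)
  have wi: "axis i 1 \<bullet> w = 0"
    by (simp add: w_def r inner_diff_right inner_axis_axis)
  have "w \<bullet> w = 1 - r\<^sup>2"
    using r fv1 by (simp add: w_def inner_simps inner_commute inner_axis_axis power2_eq_square)
  then have nw: "norm w = sqrt (1 - r\<^sup>2)" and "0 \<le> 1 - r\<^sup>2"
    by (auto simp: norm_eq_sqrt_inner) (metis inner_ge_zero diff_ge_0_iff_ge)
  then have ny: "norm w = norm y" by (simp add: y_def)
  have yi: "axis i 1 \<bullet> y = 0" using \<open>i \<noteq> j\<close> by (simp add: y_def inner_axis_axis)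
  let ?g = "H (w - y) \<circ> f"
  have og: "orthogonal_transformation ?g"
    using orthogonal_transformation_compose[OF H of] .
  \<comment> \<open>Both \<open>w\<close> and \<open>y\<close> are orthogonal to the axis
    \<open>i\<close>, so the axis lies in the mirror.\<close>
  have i: "H (w - y) (axis i 1) = axis i 1"
    by (rule fix_orth) (simp add: inner_diff_right wi yi)
  have lin: "linear (H (w - y))" using H by (simp add: orthogonal_transformation_linear)
  have "f v = r *\<^sub>R axis i 1 + w" by (simp add: w_def)
  then have "?g v = r *\<^sub>R axis i 1 + y"
    by (simp add: linear_add[OF lin] linear_scale[OF lin] i swap[OF ny])
  then show thesis using that[OF og] i fu unfolding y_def r_def by simp
qed

text \<open>After a rotation that leaves the law unchanged, both inner products involve only the
  independent coordinates \<open>i\<close> and \<open>j\<close>. Correlations \<open>1\<close> and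
  \<open>- 1\<close> are included.\<close>

lemma distr_std_normal_vector_inner_pair:
  fixes u v :: "real ^ 'n" and i j :: 'n
  assumes u: "norm u = 1" and v: "norm v = 1" and ij: "i \<noteq> j"
  shows "distr std_normal_vector (borel \<Otimes>\<^sub>M borel) (\<lambda>x. (u \<bullet> x, v \<bullet> x))
    = distr (std_normal_distribution \<Otimes>\<^sub>M std_normal_distribution) (borel \<Otimes>\<^sub>M borel)
        (\<lambda>(x, w). (x, (u \<bullet> v) * x + sqrt (1 - (u \<bullet> v)\<^sup>2) * w))"
proof -
  obtain f :: "real ^ 'n \<Rightarrow> real ^ 'n" where f: "orthogonal_transformation f" "f u = axis i 1"
    "f v = (u \<bullet> v) *\<^sub>R axis i 1 + sqrt (1 - (u \<bullet> v)\<^sup>2) *\<^sub>R axis j 1"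
    using orthogonal_transformation_two_units[OF u v ij] .
  have [measurable]: "f \<in> borel_measurable borel"
    using orthogonal_transformation_linear[OF f(1)]
    by (intro borel_measurable_continuous_onI linear_continuous_on)
      (simp add: linear_conv_bounded_linear)
  define F where "F = (\<lambda>(x :: real, w :: real). (x, (u \<bullet> v) * x + sqrt (1 - (u \<bullet> v)\<^sup>2) * w))"
  have [measurable]: "F \<in> borel \<Otimes>\<^sub>M borel \<rightarrow>\<^sub>M borel \<Otimes>\<^sub>M borel"
    unfolding F_def by measurable
  have "u \<bullet> x = f x $ i" "v \<bullet> x = (u \<bullet> v) * f x $ i + sqrt (1 - (u \<bullet> v)\<^sup>2) * f x $ j" for x
  proof -
    have *: "f y \<bullet> f x = y \<bullet> x" for y using f(1) by (simp add: orthogonal_transformation_def)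
    show "u \<bullet> x = f x $ i" "v \<bullet> x = (u \<bullet> v) * f x $ i + sqrt (1 - (u \<bullet> v)\<^sup>2) * f x $ j"
      using *[of u] *[of v] unfolding f(2,3) by (simp_all add: inner_simps inner_axis' )
  qed
  then have "(\<lambda>x. (u \<bullet> x, v \<bullet> x)) = (\<lambda>x. F (x $ i, x $ j)) \<circ> f"
    by (auto simp: F_def)
  then have "distr std_normal_vector (borel \<Otimes>\<^sub>M borel) (\<lambda>x. (u \<bullet> x, v \<bullet> x))
      = distr (distr std_normal_vector borel f) (borel \<Otimes>\<^sub>M borel) (\<lambda>x. F (x $ i, x $ j))"
    by (subst distr_distr) auto
  also have "\<dots> = distr (distr std_normal_vector (borel \<Otimes>\<^sub>M borel) (\<lambda>x. (x $ i, x $ j))) (borel \<Otimes>\<^sub>M borel) F"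
    by (subst distr_distr) (auto simp: o_def distr_std_normal_vector_orthogonal[OF f(1)])
  finally show ?thesis
    by (simp add: distr_std_normal_vector_pair[OF ij] F_def)
qed

section \<open>Plackett's identity\<close>

lemma measure_std_normal_Ioc: "a \<le> b \<Longrightarrow> measure std_normal_distribution {a<..b} = Phi b - Phi a"
proof -
  interpret real_distribution std_normal_distribution by (rule real_dist_normal_dist)
  show "a \<le> b \<Longrightarrow> measure std_normal_distribution {a<..b} = Phi b - Phi a"
    using cdf_diff_eq[of a b] by (cases "a = b") (auto simp: Phi_def)
qed

lemma AE_std_normal_neq: "AE x in std_normal_distribution. x \<noteq> a"
  by (simp add: AE_density) (use AE_lborel_singleton[of a] in eventually_elim, simp)

lemma measure_std_normal_Icc: "a \<le> b \<Longrightarrow> measure std_normal_distribution {a..b} = Phi b - Phi a"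
proof -
  interpret prob_space std_normal_distribution by (rule prob_space_std_normal)
  have "measure std_normal_distribution {a..b} = measure std_normal_distribution {a<..b}"
    by (rule finite_measure_eq_AE) (use AE_std_normal_neq[of a] in \<open>eventually_elim, auto\<close>)
  then show "a \<le> b \<Longrightarrow> ?thesis" by (simp add: measure_std_normal_Ioc)
qed

lemma continuous_on_std_normal_density [continuous_intros]:
  "continuous_on A f \<Longrightarrow> continuous_on A (\<lambda>x. std_normal_density (f x))"
  unfolding std_normal_density_def by (intro continuous_intros) auto

lemma Phi_diff_integral:
  assumes "a \<le> b"
  shows "Phi b - Phi a = integral {a..b} std_normal_density"
proof -
  have int: "set_integrable lborel {a..b} std_normal_density"
    by (intro borel_integrable_atLeastAtMost' continuous_intros)
  have "Phi b - Phi a = (\<integral>x. indicator {a..b} x \<partial>std_normal_distribution)"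
    by (simp add: measure_std_normal_Icc[OF assms])
  also have "\<dots> = (LINT x:{a..b}|lborel. std_normal_density x)"
    by (subst integral_density) (auto simp: set_lebesgue_integral_def mult.commute)
  finally show ?thesis
    using set_borel_integral_eq_integral(2)[OF int] by simp
qed

lemma has_real_derivative_Phi: "(Phi has_real_derivative std_normal_density x) (at x)"
proof -
  have "((\<lambda>u. integral {x - 1..u} std_normal_density) has_real_derivative std_normal_density x)
      (at x within {x - 1..x + 1})"
    by (rule integral_has_real_derivative) (auto intro!: continuous_intros)
  then have "((\<lambda>u. Phi u - Phi (x - 1)) has_real_derivative std_normal_density x)
      (at x within {x - 1..x + 1})"
    by (rule has_field_derivative_transform_within[where d=1])
      (auto simp: Phi_diff_integral)
  then have "((\<lambda>u. Phi u - Phi (x - 1)) has_real_derivative std_normal_density x) (at x)"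
    by (subst (asm) at_within_interior) auto
  from DERIV_add[OF this DERIV_const[of "Phi (x - 1)"]] show ?thesis by simp
qed

lemmas has_real_derivative_Phi' [derivative_intros] = DERIV_chain2[OF has_real_derivative_Phi]

lemma continuous_on_Phi [continuous_intros]:
  "continuous_on A f \<Longrightarrow> continuous_on A (\<lambda>x. Phi (f x))"
  using continuous_on_compose2[of UNIV Phi A f] DERIV_continuous_on[of UNIV Phi std_normal_density]
  by (auto simp: has_real_derivative_Phi)

lemma Phi_mono: "a \<le> b \<Longrightarrow> Phi a \<le> Phi b"
proof -
  interpret real_distribution std_normal_distribution by (rule real_dist_normal_dist)
  show "a \<le> b \<Longrightarrow> Phi a \<le> Phi b"
    by (simp add: Phi_def cdf_nondecreasing)
qed

lemma Phi_at_top: "(Phi \<longlongrightarrow> 1) at_top" and Phi_at_bot: "(Phi \<longlongrightarrow> 0) at_bot"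
proof -
  interpret real_distribution std_normal_distribution by (rule real_dist_normal_dist)
  show "(Phi \<longlongrightarrow> 1) at_top" "(Phi \<longlongrightarrow> 0) at_bot"
    by (simp_all add: Phi_def cdf_lim_at_top_prob cdf_lim_at_bot)
qed

text \<open>The density is even, so \<open>Phi x + Phi (- x)\<close> has derivative zero; its
  constant value is its limit \<open>1\<close> at infinity.\<close>

lemma Phi_minus: "Phi (- x) = 1 - Phi x"
proof -
  let ?h = "\<lambda>x. Phi x + Phi (- x)"
  have "(?h has_real_derivative 0) (at x)" for x
    by (auto intro!: derivative_eq_intros simp: std_normal_density_def)
  then have const: "?h y = ?h x" for y
    using DERIV_isconst_all[of ?h y x] by blast
  have "(?h \<longlongrightarrow> 1 + 0) at_top"
    by (intro tendsto_add Phi_at_top filterlim_compose[OF Phi_at_bot] filterlim_uminus_at_bot_at_top)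
  moreover have "(?h \<longlongrightarrow> ?h x) at_top"
    by (subst const[abs_def]) (rule tendsto_const)
  ultimately show ?thesis
    using tendsto_unique[of "at_top :: real filter" ?h] by fastforce
qed

text \<open>\<open>inv\<close> returns a preimage as soon as one exists; the limits \<open>0\<close>
  and \<open>1\<close> of \<open>Phi\<close> and the intermediate value theorem provide it.\<close>

lemma Phi_quantile:
  assumes "0 < u" "u < 1"
  shows "Phi (std_normal_quantile u) = u"
proof -
  obtain a where a: "Phi a < u"
    using order_tendstoD(2)[OF Phi_at_bot assms(1)] by (auto simp: eventually_at_bot_linorder)
  obtain b where b: "u < Phi b"
    using order_tendstoD(1)[OF Phi_at_top assms(2)] by (auto simp: eventually_at_top_linorder)
  have "a \<le> b" using a b Phi_mono[of b a] by linarith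
  then obtain x where "Phi x = u"
    using IVT'[of Phi a u b] a b continuous_on_Phi[OF continuous_on_id] by force
  then show ?thesis
    unfolding std_normal_quantile_def by (metis f_inv_into_f rangeI)
qed

lemma std_normal_quantile_less:
  assumes "0 < u" "u < 1" "u < Phi q"
  shows "std_normal_quantile u < q"
  using Phi_mono[of q "std_normal_quantile u"] Phi_quantile[OF assms(1,2)] assms(3) by linarith

section \<open>The joint density of two standard normal variables with correlation
  \<open>r\<close>\<close>

definition bivariate_density :: "real \<Rightarrow> real \<Rightarrow> real \<Rightarrow> real" where
  "bivariate_density r x y
     = exp (- (x\<^sup>2 + y\<^sup>2 - 2 * r * x * y) / (2 * (1 - r\<^sup>2))) / (2 * pi * sqrt (1 - r\<^sup>2))"

text \<open>Completing the square splits the joint density into the marginal of \<open>x\<close> and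
  the normal law of \<open>y\<close> given \<open>x\<close>, with mean \<open>r * x\<close> and
  variance \<open>1 - r\<^sup>2\<close>. The factor \<open>sqrt (1 - r\<^sup>2)\<close> appears
  because the conditional density is written in the standardised variable.\<close>

lemma bivariate_density_eq:
  assumes "\<bar>r\<bar> < 1"
  shows "std_normal_density x * std_normal_density ((y - r * x) / sqrt (1 - r\<^sup>2))
    = sqrt (1 - r\<^sup>2) * bivariate_density r x y"
proof -
  have r: "1 - r\<^sup>2 > 0" using assms by (simp add: abs_square_less_1)
  have alg: "x\<^sup>2 * (1 - r\<^sup>2) + (y - r * x)\<^sup>2 = x\<^sup>2 + y\<^sup>2 - 2 * r * x * y"
    by (simp add: power2_eq_square algebra_simps)
  have "- x\<^sup>2 / 2 + - ((y - r * x) / sqrt (1 - r\<^sup>2))\<^sup>2 / 2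
      = - (x\<^sup>2 * (1 - r\<^sup>2) + (y - r * x)\<^sup>2) / (2 * (1 - r\<^sup>2))"
  proof -
    have "- X / 2 + - (Y / d) / 2 = - (X * d + Y) / (2 * d)" if "d > 0" for X Y d :: real
      using that by (simp add: field_simps)
    from this[OF r] show ?thesis
      unfolding power_divide real_sqrt_pow2[OF less_imp_le[OF r]] .
  qed
  then have "exp (- x\<^sup>2 / 2) * exp (- ((y - r * x) / sqrt (1 - r\<^sup>2))\<^sup>2 / 2)
      = exp (- (x\<^sup>2 + y\<^sup>2 - 2 * r * x * y) / (2 * (1 - r\<^sup>2)))"
    unfolding alg exp_add[symmetric] by simp
  moreover have "sqrt (2 * pi) * sqrt (2 * pi) = 2 * pi" by simp
  ultimately show ?thesis
    using r by (simp add: std_normal_density_def bivariate_density_def)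
qed

lemma DERIV_bivariate_density:
  assumes "\<bar>r\<bar> < 1"
  shows "((\<lambda>x. bivariate_density r x y) has_real_derivative
    bivariate_density r x y * ((r * y - x) / (1 - r\<^sup>2))) (at x within A)"
proof -
  have r: "1 - r\<^sup>2 > 0" using assms by (simp add: abs_square_less_1)
  have "((\<lambda>x. - (x\<^sup>2 + y\<^sup>2 - 2 * r * x * y)) has_real_derivative 2 * (r * y - x)) (at x within A)"
    by (auto intro!: derivative_eq_intros)
  from DERIV_cdivide[OF this, of "2 * (1 - r\<^sup>2)"]
  have "((\<lambda>x. - (x\<^sup>2 + y\<^sup>2 - 2 * r * x * y) / (2 * (1 - r\<^sup>2))) has_real_derivative
      (r * y - x) / (1 - r\<^sup>2)) (at x within A)"
    by (simp only: mult_divide_mult_cancel_left[OF zero_neq_numeral[symmetric]])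
  from DERIV_cdivide[OF DERIV_chain2[OF DERIV_exp this], of "2 * pi * sqrt (1 - r\<^sup>2)"]
  show ?thesis
    unfolding bivariate_density_def times_divide_eq_left .
qed

text \<open>\<open>Phi\<close> of the standardised bound is the conditional probability that the
  second variable is at most \<open>y\<close>. Its derivative in \<open>r\<close>, weighted by the
  marginal density, is the same expression as the derivative in \<open>x\<close> found in
  \<open>DERIV_bivariate_density\<close>.\<close>

lemma DERIV_conditional_Phi:
  assumes "\<bar>r\<bar> < 1"
  shows "((\<lambda>r. std_normal_density x * Phi ((y - r * x) / sqrt (1 - r\<^sup>2))) has_real_derivative
    bivariate_density r x y * ((r * y - x) / (1 - r\<^sup>2))) (at r within A)"
proof -
  have r: "1 - r\<^sup>2 > 0" using assms by (simp add: abs_square_less_1)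
  define s where "s = sqrt (1 - r\<^sup>2)"
  have s: "s > 0" "s\<^sup>2 = 1 - r\<^sup>2" using r by (auto simp: s_def)
  have num: "((\<lambda>r. y - r * x) has_real_derivative - x) (at r within A)"
    by (auto intro!: derivative_eq_intros)
  have "((\<lambda>r. 1 - r\<^sup>2) has_real_derivative - 2 * r) (at r within A)"
    by (auto intro!: derivative_eq_intros)
  from DERIV_chain2[where g = "\<lambda>r. 1 - r\<^sup>2", OF DERIV_real_sqrt[OF r] this]
  have "((\<lambda>r. sqrt (1 - r\<^sup>2)) has_real_derivative inverse s / 2 * (- 2 * r)) (at r within A)"
    unfolding s_def .
  moreover have "inverse s / 2 * (- 2 * r) = - r / s"
    using s(1) by (simp add: field_simps)
  ultimately have den: "((\<lambda>r. sqrt (1 - r\<^sup>2)) has_real_derivative - r / s) (at r within A)"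
    by simp
  have "((\<lambda>r. (y - r * x) / sqrt (1 - r\<^sup>2)) has_real_derivative
      (- x * s - (y - r * x) * (- r / s)) / (s * s)) (at r within A)"
    using DERIV_divide[OF num den] s(1) by (simp add: s_def)
  \<comment> \<open>Extending the fraction by \<open>s\<close> leaves only \<open>s\<^sup>2\<close>
    in the numerator, which then collapses to \<open>r * y - x\<close>.\<close>
  also have "(- x * s - (y - r * x) * (- r / s)) / (s * s)
      = (- x * s\<^sup>2 + (y - r * x) * r) / (s * s\<^sup>2)"
  proof -
    have "(- x * s - d * (- r / s)) / (s * s) = (- x * s\<^sup>2 + d * r) / (s * s\<^sup>2)" for d
      using s(1) by (simp add: divide_simps) (simp add: power2_eq_square)
    then show ?thesis .
  qed
  also have "- x * s\<^sup>2 + (y - r * x) * r = r * y - x"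
    unfolding s(2) by (simp add: algebra_simps power2_eq_square)
  finally have "((\<lambda>r. std_normal_density x * Phi ((y - r * x) / sqrt (1 - r\<^sup>2))) has_real_derivative
      std_normal_density x * (std_normal_density ((y - r * x) / sqrt (1 - r\<^sup>2))
        * ((r * y - x) / (s * s\<^sup>2)))) (at r within A)"
    by (rule DERIV_cmult[OF has_real_derivative_Phi'])
  moreover have "std_normal_density x * (std_normal_density ((y - r * x) / sqrt (1 - r\<^sup>2)) * t)
      = s * bivariate_density r x y * t" for t
    unfolding mult.assoc[symmetric] bivariate_density_eq[OF assms] s_def ..
  moreover have "s * D * (t / (s * s\<^sup>2)) = D * (t / (1 - r\<^sup>2))" for D t
    using s by simp
  ultimately show ?thesis by (simp only:)
qed

text \<open>Plackett's identity: the parameter derivative of the conditional probability is an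
  \<open>x\<close>-derivative of the joint density, so its integral reduces to corner values.\<close>

lemma DERIV_integral_conditional_Phi:
  assumes r0: "\<bar>r\<bar> < 1" and "x1 \<le> x2"
  shows "((\<lambda>r. integral {x1..x2} (\<lambda>x. std_normal_density x * Phi ((y - r * x) / sqrt (1 - r\<^sup>2))))
    has_real_derivative bivariate_density r x2 y - bivariate_density r x1 y) (at r)"
proof -
  let ?U = "{-1<..<1::real}"
  let ?g = "\<lambda>r x. bivariate_density r x y * ((r * y - x) / (1 - r\<^sup>2))"
  have pos: "1 - r\<^sup>2 > 0" if "\<bar>r\<bar> < 1" for r :: real
    using that by (simp add: abs_square_less_1)
  \<comment> \<open>Differentiation under the integral sign is legitimate on the convex set
    \<open>?U\<close>, where the derivative is jointly continuous because
    \<open>1 - r\<^sup>2\<close> does not vanish.\<close>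
  have "((\<lambda>r. integral (cbox x1 x2) (\<lambda>x. std_normal_density x * Phi ((y - r * x) / sqrt (1 - r\<^sup>2))))
      has_real_derivative integral (cbox x1 x2) (?g r)) (at r within ?U)"
  proof (rule leibniz_rule_field_derivative)
    show "((\<lambda>r. std_normal_density x * Phi ((y - r * x) / sqrt (1 - r\<^sup>2))) has_real_derivative ?g r x)
        (at r within ?U)" if "r \<in> ?U" for r x
      using that by (intro DERIV_conditional_Phi) auto
    show "(\<lambda>x. std_normal_density x * Phi ((y - r * x) / sqrt (1 - r\<^sup>2))) integrable_on cbox x1 x2"
      if "r \<in> ?U" for r
      using that by (intro integrable_continuous continuous_intros) (auto simp: power2_eq_1_iff)
    show "continuous_on (?U \<times> cbox x1 x2) (\<lambda>(r, x). ?g r x)"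
      unfolding bivariate_density_def case_prod_beta
      by (intro continuous_intros) (auto simp: power2_eq_1_iff abs_less_iff)
  qed (use r0 in auto)
  moreover have "(?g r has_integral bivariate_density r x2 y - bivariate_density r x1 y) {x1..x2}"
    using \<open>x1 \<le> x2\<close> DERIV_bivariate_density[OF r0]
    by (intro fundamental_theorem_of_calculus)
      (auto simp: has_real_derivative_iff_has_vector_derivative[symmetric])
  then have "integral (cbox x1 x2) (?g r) = bivariate_density r x2 y - bivariate_density r x1 y"
    unfolding box_real by (rule integral_unique)
  moreover have "at r within ?U = at r"
    using r0 by (intro at_within_open) auto
  ultimately show ?thesis by simp
qed

section \<open>The probability of the square as a function of the correlation\<close>

lemma band_measurable:
  "{(x, w). \<bar>a + x\<bar> \<le> c \<and> \<bar>b + (r * x + sqrt (1 - r\<^sup>2) * w)\<bar> \<le> c}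
    \<in> sets (std_normal_distribution \<Otimes>\<^sub>M std_normal_distribution)"
proof -
  have "closed {z :: real \<times> real. \<bar>a + fst z\<bar> \<le> c \<and> \<bar>b + (r * fst z + sqrt (1 - r\<^sup>2) * snd z)\<bar> \<le> c}"
    by (intro closed_Collect_conj closed_Collect_le continuous_intros)
  also have "?this \<longleftrightarrow> closed {(x, w). \<bar>a + x\<bar> \<le> c \<and> \<bar>b + (r * x + sqrt (1 - r\<^sup>2) * w)\<bar> \<le> c}"
    by (intro arg_cong[of _ _ closed]) auto
  finally have "{(x, w). \<bar>a + x\<bar> \<le> c \<and> \<bar>b + (r * x + sqrt (1 - r\<^sup>2) * w)\<bar> \<le> c}
      \<in> sets (borel :: (real \<times> real) measure)"
    by (rule borel_closed)
  also have "sets (borel :: (real \<times> real) measure)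
      = sets (std_normal_distribution \<Otimes>\<^sub>M std_normal_distribution)"
    unfolding borel_prod[symmetric] by (intro sets_pair_measure_cong) auto
  finally show ?thesis .
qed

text \<open>This is the function \<open>G\<close> of the overview. The correlated pair is built from
  independent variables \<open>x\<close> and \<open>w\<close>, so the definition remains meaningful
  at \<open>r = 1\<close>, where there is no joint density.\<close>

definition band_prob :: "real \<Rightarrow> real \<Rightarrow> real \<Rightarrow> real \<Rightarrow> real" where
  "band_prob c a b r = measure (std_normal_distribution \<Otimes>\<^sub>M std_normal_distribution)
     {(x, w). \<bar>a + x\<bar> \<le> c \<and> \<bar>b + (r * x + sqrt (1 - r\<^sup>2) * w)\<bar> \<le> c}"

lemma band_prob_eq_integral:
  assumes r: "\<bar>r\<bar> < 1" and c: "0 < c"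
  shows "band_prob c a b r =
    integral {- a - c..- a + c} (\<lambda>x. std_normal_density x * Phi ((- b + c - r * x) / sqrt (1 - r\<^sup>2)))
    - integral {- a - c..- a + c} (\<lambda>x. std_normal_density x * Phi ((- b - c - r * x) / sqrt (1 - r\<^sup>2)))"
proof -
  let ?N = std_normal_distribution
  interpret N: prob_space ?N by (rule prob_space_std_normal)
  interpret NN: pair_prob_space ?N ?N ..
  let ?I = "{- a - c..- a + c}"
  define s where "s = sqrt (1 - r\<^sup>2)"
  have s: "s > 0" using r by (simp add: s_def abs_square_less_1)
  let ?A = "{(x, w). \<bar>a + x\<bar> \<le> c \<and> \<bar>b + (r * x + s * w)\<bar> \<le> c}"
  let ?g = "\<lambda>y x. std_normal_density x * Phi ((y - r * x) / s)"
  have A: "?A \<in> sets (?N \<Otimes>\<^sub>M ?N)"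
    unfolding s_def by (rule band_measurable)
  have cont: "continuous_on ?I (?g y)" for y
    using s by (intro continuous_intros) auto
  have "band_prob c a b r = (\<integral>z. indicator ?A z \<partial>(?N \<Otimes>\<^sub>M ?N))"
    by (simp add: band_prob_def s_def space_pair_measure)
  also have "\<dots> = (\<integral>x. (\<integral>w. indicator ?A (x, w) \<partial>?N) \<partial>?N)"
    by (rule NN.integral_fst'[symmetric]) (use A in \<open>simp add: NN.P.emeasure_finite less_top[symmetric]\<close>)
  also have "\<dots> = (\<integral>x. indicator ?I x * (Phi ((- b + c - r * x) / s) - Phi ((- b - c - r * x) / s)) \<partial>?N)"
  proof (rule Bochner_Integration.integral_cong[OF refl])
    fix x
    \<comment> \<open>For fixed \<open>x\<close>, dividing by \<open>s > 0\<close> turns the second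
      constraint into an interval for \<open>w\<close>.\<close>
    have "(\<integral>w. indicator ?A (x, w) \<partial>?N :: real)
        = (\<integral>w. indicator ?I x * indicator {(- b - c - r * x) / s..(- b + c - r * x) / s} w \<partial>?N)"
      using s by (intro Bochner_Integration.integral_cong) (auto simp: indicator_def abs_le_iff field_simps)
    also have "\<dots> = indicator ?I x * measure ?N {(- b - c - r * x) / s..(- b + c - r * x) / s}"
      by simp
    also have "measure ?N {(- b - c - r * x) / s..(- b + c - r * x) / s}
        = Phi ((- b + c - r * x) / s) - Phi ((- b - c - r * x) / s)"
      using s c by (intro measure_std_normal_Icc divide_right_mono) auto
    finally show "(\<integral>w. indicator ?A (x, w) \<partial>?N)
        = indicator ?I x * (Phi ((- b + c - r * x) / s) - Phi ((- b - c - r * x) / s))" .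
  qed
  also have "\<dots> = (LINT x:?I|lborel. ?g (- b + c) x - ?g (- b - c) x)"
  proof -
    have "(\<lambda>x. Phi ((y - r * x) / s)) \<in> borel_measurable borel" for y
      using s by (intro borel_measurable_continuous_onI continuous_intros) auto
    then have [measurable]: "(\<lambda>x. Phi ((- b + c - r * x) / s)) \<in> borel_measurable borel"
      "(\<lambda>x. Phi ((- b - c - r * x) / s)) \<in> borel_measurable borel" by auto
    show ?thesis
      unfolding set_lebesgue_integral_def
      by (subst integral_density, measurable)
        (auto simp: algebra_simps intro!: Bochner_Integration.integral_cong)
  qed
  also have "\<dots> = integral ?I (\<lambda>x. ?g (- b + c) x - ?g (- b - c) x)"
    by (intro set_borel_integral_eq_integral(2) borel_integrable_atLeastAtMost' continuous_on_diff cont)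
  also have "\<dots> = integral ?I (?g (- b + c)) - integral ?I (?g (- b - c))"
    by (intro Henstock_Kurzweil_Integration.integral_diff integrable_continuous_real cont)
  finally show ?thesis by (simp add: s_def)
qed

definition corner_sum :: "real \<Rightarrow> real \<Rightarrow> real \<Rightarrow> real \<Rightarrow> real" where
  "corner_sum c a b r = bivariate_density r (- a + c) (- b + c) - bivariate_density r (- a - c) (- b + c)
     - bivariate_density r (- a + c) (- b - c) + bivariate_density r (- a - c) (- b - c)"

text \<open>Plackett's identity is applied to the upper and the lower edge of the square; the
  difference collects the four corners.\<close>

lemma DERIV_band_prob:
  assumes r: "\<bar>r\<bar> < 1" and c: "0 < c"
  shows "(band_prob c a b has_real_derivative corner_sum c a b r) (at r)"
proof (rule has_field_derivative_transform_within)
  let ?J = "\<lambda>y r. integral {- a - c..- a + c} (\<lambda>x. std_normal_density x * Phi ((y - r * x) / sqrt (1 - r\<^sup>2)))"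
  show "((\<lambda>r. ?J (- b + c) r - ?J (- b - c) r) has_real_derivative corner_sum c a b r) (at r)"
    using DERIV_diff[OF DERIV_integral_conditional_Phi DERIV_integral_conditional_Phi, OF r _ r,
        of "- a - c" "- a + c" "- a - c" "- a + c" "- b + c" "- b - c"] c
    by (simp add: corner_sum_def algebra_simps)
  \<comment> \<open>Within this distance of \<open>r\<close> the correlation stays inside the range
    in which the integral formula holds.\<close>
  show "?J (- b + c) q - ?J (- b - c) q = band_prob c a b q" if "dist q r < 1 - \<bar>r\<bar>" for q
    using that c by (intro band_prob_eq_integral[symmetric]) (auto simp: dist_real_def)
  show "0 < 1 - \<bar>r\<bar>" using r by simp
qed simp

text \<open>At most two values of the first coordinate are excluded, a null set. At correlation
  \<open>1\<close> they are the points whose second component \<open>b + fst z\<close> meets the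
  boundary of the band.\<close>

lemma AE_pair_std_normal_abs_neq:
  "AE z in std_normal_distribution \<Otimes>\<^sub>M std_normal_distribution. \<bar>b + fst z\<bar> \<noteq> c"
proof (rule pair_sigma_finite.AE_pair_measure)
  let ?N = std_normal_distribution
  show "pair_sigma_finite ?N ?N"
    by (intro pair_sigma_finite.intro prob_space_imp_sigma_finite prob_space_std_normal)
  have f: "(\<lambda>z. \<bar>b + fst z\<bar>) \<in> borel_measurable (?N \<Otimes>\<^sub>M ?N)"
    by measurable
  show "{z \<in> space (?N \<Otimes>\<^sub>M ?N). \<bar>b + fst z\<bar> \<noteq> c} \<in> sets (?N \<Otimes>\<^sub>M ?N)"
    using measurable_sets[OF f, of "- {c}"] by (simp add: vimage_def Int_def conj_commute)
  have "AE x in ?N. \<bar>b + x\<bar> \<noteq> c"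
    using AE_std_normal_neq[of "c - b"] AE_std_normal_neq[of "- c - b"]
    by (rule AE_mp[OF AE_conjI]) (intro AE_I2, auto)
  then show "AE x in ?N. AE w in ?N. \<bar>b + fst (x, w)\<bar> \<noteq> c"
    by (rule AE_mp) (intro AE_I2 impI, simp)
qed

lemma eventually_le_iff_limit_le:
  fixes y :: "'b \<Rightarrow> 'a::order_topology"
  assumes lim: "(y \<longlongrightarrow> l) F" and "l \<noteq> c" "l \<le> c \<or> c \<le> l"
  shows "eventually (\<lambda>n. y n \<le> c \<longleftrightarrow> l \<le> c) F"
proof (cases "l < c")
  case True
  from order_tendstoD(2)[OF lim True] show ?thesis
    by (rule eventually_mono) (use True in auto)
next
  case False
  with assms(2,3) have "c < l" by auto
  from order_tendstoD(1)[OF lim this] show ?thesis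
    by (rule eventually_mono) (use \<open>c < l\<close> in auto)
qed

text \<open>The second component converges pointwise to \<open>b + fst z\<close>. Off the null set
  where this limit lies on the boundary, membership in the band is eventually that of the
  limit.\<close>

lemma band_prob_tendsto_1:
  assumes X: "X \<longlonglongrightarrow> 1"
  shows "(\<lambda>n. band_prob c a b (X n)) \<longlonglongrightarrow> band_prob c a b 1"
  unfolding band_prob_def
proof (rule finite_measure.measure_tendsto_AE)
  let ?NN = "std_normal_distribution \<Otimes>\<^sub>M std_normal_distribution"
  let ?A = "\<lambda>r. {(x, w). \<bar>a + x\<bar> \<le> c \<and> \<bar>b + (r * x + sqrt (1 - r\<^sup>2) * w)\<bar> \<le> c}"
  show "finite_measure ?NN"
    by (intro prob_space.finite_measure prob_space_pair prob_space_std_normal)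
  show "?A (X n) \<in> sets ?NN" "?A 1 \<in> sets ?NN" for n
    by (rule band_measurable)+
  have "eventually (\<lambda>n. z \<in> ?A (X n) \<longleftrightarrow> z \<in> ?A 1) sequentially" if z: "\<bar>b + fst z\<bar> \<noteq> c" for z
  proof -
    let ?h = "\<lambda>r. \<bar>b + (r * fst z + sqrt (1 - r\<^sup>2) * snd z)\<bar>"
    have "isCont ?h 1" by (intro continuous_intros)
    from isCont_tendsto_compose[OF this X]
    have "(\<lambda>n. ?h (X n)) \<longlonglongrightarrow> \<bar>b + fst z\<bar>" by simp
    from eventually_le_iff_limit_le[OF this z linear] show ?thesis
      by (rule eventually_mono) (simp add: case_prod_beta)
  qed
  then have "AE z in ?NN. \<bar>b + fst z\<bar> \<noteq> c
      \<longrightarrow> eventually (\<lambda>n. z \<in> ?A (X n) \<longleftrightarrow> z \<in> ?A 1) sequentially"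
    by (intro AE_I2) blast
  with AE_pair_std_normal_abs_neq[of b c]
  show "AE z in ?NN. eventually (\<lambda>n. z \<in> ?A (X n) \<longleftrightarrow> z \<in> ?A 1) sequentially"
    by (rule AE_mp)
qed

lemma continuous_on_band_prob:
  assumes "0 < c" "r \<le> 1"
  shows "continuous_on {0..r} (band_prob c a b)"
proof -
  have "continuous (at q within {0..1}) (band_prob c a b)" if "q \<in> {0..1}" for q
  proof (cases "q = 1")
    case True
    show ?thesis
      unfolding True continuous_within_sequentially o_def
      by (intro allI impI, elim conjE, rule band_prob_tendsto_1)
  next
    case False
    with that have "\<bar>q\<bar> < 1" by simp
    from DERIV_isCont[OF DERIV_band_prob[OF this \<open>0 < c\<close>]] show ?thesis
      by (rule continuous_at_imp_continuous_at_within)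
  qed
  then have "continuous_on {0..1} (band_prob c a b)"
    unfolding continuous_on_eq_continuous_within by blast
  then show ?thesis
    by (rule continuous_on_subset) (use assms in auto)
qed

text \<open>The sign of the derivative is required only on the open interval, and continuity handles
  the endpoints; \<open>r = 1\<close> is thus allowed although \<open>corner_sum\<close> is not the
  derivative there.\<close>

lemma band_prob_increasing:
  assumes "0 < c" "0 < r" "r \<le> 1"
    and "\<And>q. 0 < q \<Longrightarrow> q < r \<Longrightarrow> 0 < corner_sum c a b q"
  shows "band_prob c a b 0 < band_prob c a b r"
proof (rule DERIV_pos_imp_increasing_open[OF \<open>0 < r\<close>])
  fix q assume "0 < q" "q < r"
  with assms show "\<exists>y. (band_prob c a b has_real_derivative y) (at q) \<and> 0 < y"
    by (intro exI[of _ "corner_sum c a b q"] conjI DERIV_band_prob) auto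
qed (use assms in \<open>intro continuous_on_band_prob\<close>)

lemma band_prob_decreasing:
  assumes "0 < c" "0 < r" "r \<le> 1"
    and "\<And>q. 0 < q \<Longrightarrow> q < r \<Longrightarrow> corner_sum c a b q < 0"
  shows "band_prob c a b r < band_prob c a b 0"
proof (rule DERIV_neg_imp_decreasing_open[OF \<open>0 < r\<close>])
  fix q assume "0 < q" "q < r"
  with assms show "\<exists>y. (band_prob c a b has_real_derivative y) (at q) \<and> y < 0"
    by (intro exI[of _ "corner_sum c a b q"] conjI DERIV_band_prob) auto
qed (use assms in \<open>intro continuous_on_band_prob\<close>)

text \<open>At correlation \<open>0\<close> the band is a rectangle; this product is what the
  covariance subtracts.\<close>

lemma band_prob_0:
  "band_prob c a b 0 = measure std_normal_distribution {x. \<bar>a + x\<bar> \<le> c}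
    * measure std_normal_distribution {x. \<bar>b + x\<bar> \<le> c}"
proof -
  let ?N = std_normal_distribution
  interpret N: prob_space ?N by (rule prob_space_std_normal)
  interpret NN: pair_prob_space ?N ?N ..
  have "{(x, w). \<bar>a + x\<bar> \<le> c \<and> \<bar>b + w\<bar> \<le> c} = {x. \<bar>a + x\<bar> \<le> c} \<times> {x. \<bar>b + x\<bar> \<le> c}"
    by auto
  then show ?thesis
    by (simp add: band_prob_def measure_def N.emeasure_pair_measure_Times enn2real_mult)
qed

section \<open>Sign of the corner sum\<close>

text \<open>The signs \<open>e\<close> and \<open>d\<close> select the corner. As their squares are
  \<open>1\<close>, the quadratic form splits into a part common to all corners and a part linear in
  \<open>e\<close>, \<open>d\<close> and \<open>e * d\<close>.\<close>

lemma bivariate_density_corner: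
  assumes "\<bar>r\<bar> < 1" and e: "e * e = 1" and d: "d * d = 1"
  shows "bivariate_density r (- a + e * c) (- b + d * c)
    = exp (- (a\<^sup>2 + b\<^sup>2 - 2 * r * a * b + 2 * c\<^sup>2) / (2 * (1 - r\<^sup>2))) / (2 * pi * sqrt (1 - r\<^sup>2))
      * exp ((e * (c * (a - r * b)) + d * (c * (b - r * a)) + e * d * (r * c\<^sup>2)) / (1 - r\<^sup>2))"
proof -
  let ?x = "- a + e * c" and ?y = "- b + d * c"
  let ?L = "e * (c * (a - r * b)) + d * (c * (b - r * a)) + e * d * (r * c\<^sup>2)"
  have "?x\<^sup>2 + ?y\<^sup>2 - 2 * r * ?x * ?y = (a\<^sup>2 + b\<^sup>2 - 2 * r * a * b + 2 * c\<^sup>2) - 2 * ?L"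
    using e d by algebra
  then have "- (?x\<^sup>2 + ?y\<^sup>2 - 2 * r * ?x * ?y) / (2 * (1 - r\<^sup>2))
      = - (a\<^sup>2 + b\<^sup>2 - 2 * r * a * b + 2 * c\<^sup>2) / (2 * (1 - r\<^sup>2)) + (2 * ?L) / (2 * (1 - r\<^sup>2))"
    by (simp only: add_divide_distrib[symmetric]) simp
  also have "(2 * ?L) / (2 * (1 - r\<^sup>2)) = ?L / (1 - r\<^sup>2)"
    by (rule mult_divide_mult_cancel_left) simp
  finally show ?thesis
    by (simp only: bivariate_density_def exp_add times_divide_eq_left)
qed

lemma corner_sum_factor:
  assumes r: "\<bar>r\<bar> < 1"
  obtains K where "K > 0"
    "corner_sum c a b r = K *
      (exp ((r * c\<^sup>2 + (c * (a - r * b) + c * (b - r * a))) / (1 - r\<^sup>2))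
       + exp ((r * c\<^sup>2 - (c * (a - r * b) + c * (b - r * a))) / (1 - r\<^sup>2))
       - (exp ((c * (a - r * b) - c * (b - r * a) - r * c\<^sup>2) / (1 - r\<^sup>2))
          + exp ((c * (b - r * a) - c * (a - r * b) - r * c\<^sup>2) / (1 - r\<^sup>2))))"
proof -
  define A B R where "A = c * (a - r * b)" and "B = c * (b - r * a)" and "R = r * c\<^sup>2"
  \<comment> \<open>\<open>K\<close> is chosen before the signs, so one factor serves all four
    corners.\<close>
  have "\<exists>K>0. \<forall>e d. e * e = 1 \<longrightarrow> d * d = 1 \<longrightarrow> bivariate_density r (- a + e * c) (- b + d * c)
      = K * exp ((e * A + d * B + e * d * R) / (1 - r\<^sup>2))"
    unfolding A_def B_def R_def using r
    by (intro exI[of _ "exp (- (a\<^sup>2 + b\<^sup>2 - 2 * r * a * b + 2 * c\<^sup>2) / (2 * (1 - r\<^sup>2)))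
        / (2 * pi * sqrt (1 - r\<^sup>2))"] conjI allI impI bivariate_density_corner)
      (simp_all add: abs_square_less_1)
  then obtain K where K: "K > 0" and eq: "\<And>e d. e * e = 1 \<Longrightarrow> d * d = 1 \<Longrightarrow>
      bivariate_density r (- a + e * c) (- b + d * c) = K * exp ((e * A + d * B + e * d * R) / (1 - r\<^sup>2))"
    by blast
  have "bivariate_density r (- a + c) (- b + c) = K * exp ((R + (A + B)) / (1 - r\<^sup>2))"
    "bivariate_density r (- a - c) (- b - c) = K * exp ((R - (A + B)) / (1 - r\<^sup>2))"
    "bivariate_density r (- a + c) (- b - c) = K * exp ((A - B - R) / (1 - r\<^sup>2))"
    "bivariate_density r (- a - c) (- b + c) = K * exp ((B - A - R) / (1 - r\<^sup>2))"
    using eq[of 1 1] eq[of "- 1" "- 1"] eq[of 1 "- 1"] eq[of "- 1" 1]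
    by (simp_all add: algebra_simps)
  then have "corner_sum c a b r = K * (exp ((R + (A + B)) / (1 - r\<^sup>2)) + exp ((R - (A + B)) / (1 - r\<^sup>2))
      - (exp ((A - B - R) / (1 - r\<^sup>2)) + exp ((B - A - R) / (1 - r\<^sup>2))))"
    unfolding corner_sum_def by (simp only: right_diff_distrib distrib_left)
  then show thesis
    using that[OF K] unfolding A_def B_def R_def by blast
qed

text \<open>A consequence of \<open>exp\<close> being increasing and convex: \<open>p\<close>
  dominates both exponents on the left and the right-hand pair has the larger sum.\<close>

lemma exp_add_less_exp_add:
  fixes p q m n :: real
  assumes "m \<le> p" "n \<le> p" "m + n < p + q"
  shows "exp m + exp n < exp p + exp q"
proof (cases "n \<le> q \<or> m \<le> q")
  case True
  then consider "n \<le> q" "m < p \<or> n < q" | "m \<le> q" "n < p \<or> m < q"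
    using assms by linarith
  then show ?thesis
  proof cases
    case 1
    then have "exp n \<le> exp q" "exp m \<le> exp p" "exp m < exp p \<or> exp n < exp q"
      using assms by auto
    then show ?thesis by linarith
  next
    case 2
    then have "exp m \<le> exp q" "exp n \<le> exp p" "exp n < exp p \<or> exp m < exp q"
      using assms by auto
    then show ?thesis by linarith
  qed
next
  \<comment> \<open>Now \<open>q\<close> is below both \<open>m\<close> and \<open>n\<close>. The
    step from \<open>q\<close> to \<open>n\<close> is shorter than the one from \<open>m\<close> to
    \<open>p\<close> and starts lower, so \<open>exp\<close> grows less along it.\<close>
  case False
  have "exp n - exp q = exp q * (exp (n - q) - 1)"
    by (simp add: exp_diff right_diff_distrib)
  also have "\<dots> \<le> exp m * (exp (n - q) - 1)"
    using False by (intro mult_right_mono) auto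
  also have "\<dots> < exp m * (exp (p - m) - 1)"
    using assms by (intro mult_strict_left_mono) auto
  also have "\<dots> = exp p - exp m"
    by (simp add: exp_diff right_diff_distrib)
  finally show ?thesis by linarith
qed

text \<open>Multiplied by \<open>c\<close>, the two hypotheses say \<open>- R \<le> A\<close> and
  \<open>- R \<le> B\<close>. Hence \<open>R + (A + B)\<close> dominates both exponents with
  negative sign, while the sums of exponents compare as \<open>- 2 * R < 2 * R\<close>.\<close>

lemma corner_sum_pos:
  assumes "0 < c" "0 < r" "r < 1" and "r * (b - c) \<le> a" "r * (a - c) \<le> b"
  shows "0 < corner_sum c a b r"
proof -
  have r: "\<bar>r\<bar> < 1" and r2: "1 - r\<^sup>2 > 0" using assms by (auto simp: abs_square_less_1)
  define A B R where "A = c * (a - r * b)" and "B = c * (b - r * a)" and "R = r * c\<^sup>2"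
  have "R > 0" using assms by (simp add: R_def)
  have "c * (r * (b - c)) \<le> c * a" "c * (r * (a - c)) \<le> c * b"
    using assms by simp_all
  then have "- R \<le> A" "- R \<le> B"
    by (simp_all add: A_def B_def R_def algebra_simps power2_eq_square)
  have "(A - B - R) / (1 - r\<^sup>2) \<le> (R + (A + B)) / (1 - r\<^sup>2)"
    and "(B - A - R) / (1 - r\<^sup>2) \<le> (R + (A + B)) / (1 - r\<^sup>2)"
    and "(A - B - R) / (1 - r\<^sup>2) + (B - A - R) / (1 - r\<^sup>2) < (R + (A + B)) / (1 - r\<^sup>2) + (R - (A + B)) / (1 - r\<^sup>2)"
    unfolding add_divide_distrib[symmetric] using r2 \<open>R > 0\<close> \<open>- R \<le> A\<close> \<open>- R \<le> B\<close>
    by (auto intro!: divide_right_mono divide_strict_right_mono)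
  from exp_add_less_exp_add[OF this] show ?thesis
    using corner_sum_factor[OF r, of c a b, folded A_def B_def R_def]
    by (metis diff_gt_0_iff_gt mult_pos_pos)
qed

text \<open>After multiplication by \<open>z\<^sup>2\<close> the difference of the sides is a
  quartic with a double root at \<open>1\<close>. The coefficient \<open>3\<close> is the source of
  the logarithm of \<open>3\<close> in the theorem.\<close>

lemma four_times_le: "0 < (z::real) \<Longrightarrow> 4 * z \<le> 3 * z\<^sup>2 + inverse (z\<^sup>2)"
proof -
  assume z: "0 < z"
  have "0 \<le> (z - 1)\<^sup>2 * (2 * z\<^sup>2 + (z + 1)\<^sup>2)"
    by (intro mult_nonneg_nonneg add_nonneg_nonneg) auto
  also have "\<dots> = 3 * z^4 - 4 * z^3 + 1"
    by (simp add: algebra_simps eval_nat_numeral)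
  finally show ?thesis
    using z by (simp add: field_simps eval_nat_numeral)
qed

text \<open>The claim reads \<open>exp k * cosh x < cosh (x + h)\<close>, equivalently
  \<open>exp k - exp (- h) < exp (2 * x) * (exp h - exp k)\<close>. With
  \<open>z = exp (h / 2)\<close> one has \<open>exp k \<le> z\<close>, and
  \<open>four_times_le\<close> gives this bound with \<open>3\<close> in place of
  \<open>exp (2 * x)\<close>.\<close>

lemma exp_mult_cosh_less:
  fixes x h k :: real
  assumes x: "3 < exp (2 * x)" and k: "0 \<le> k" "2 * k < h"
  shows "exp (x + k) + exp (k - x) < exp (x + h) + exp (- (x + h))"
proof -
  define z where "z = exp (h / 2)"
  have z: "z > 0" "exp h = z\<^sup>2" "exp (- h) = inverse (z\<^sup>2)"
    by (simp_all add: z_def exp_double[symmetric] exp_minus)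
  have "4 * exp k \<le> 4 * z"
    using k by (simp add: z_def)
  also have "4 * z \<le> 3 * exp h + exp (- h)"
    using four_times_le[OF z(1)] by (simp add: z)
  finally have "exp k - exp (- h) \<le> 3 * (exp h - exp k)" by simp
  also have "\<dots> < exp (2 * x) * (exp h - exp k)"
    using x k by (intro mult_strict_right_mono) auto
  finally have "exp (- x) * (exp k - exp (- h)) < exp (- x) * (exp (2 * x) * (exp h - exp k))"
    by simp
  also have "\<dots> = exp x * (exp h - exp k)"
    by (simp add: mult.assoc[symmetric] exp_add[symmetric])
  finally show ?thesis
    by (simp add: algebra_simps exp_add exp_diff exp_minus divide_inverse)
qed

text \<open>For \<open>a = 0\<close> and up to division by \<open>1 - r\<^sup>2\<close>,
  \<open>x\<close> is \<open>A + B\<close>, \<open>x + h\<close> is \<open>B - A\<close> and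
  \<open>k\<close> is \<open>2 * R\<close>; a negative sign then means
  \<open>exp k * cosh x < cosh (x + h)\<close>. The bound \<open>2 * c < b\<close> yields both
  \<open>c\<^sup>2 \<le> x\<close> and \<open>2 * k < h\<close>.\<close>

lemma corner_sum_neg:
  assumes "0 < c" "0 < r" "r < 1" and b: "2 * c < b" and c2: "3 < exp (2 * c\<^sup>2)"
  shows "corner_sum c 0 b r < 0"
proof -
  have r: "\<bar>r\<bar> < 1" and r2: "1 - r\<^sup>2 > 0" using assms by (auto simp: abs_square_less_1)
  define x h k where "x = c * b / (1 + r)" and "h = 2 * c * r * b / (1 - r\<^sup>2)"
    and "k = 2 * r * c\<^sup>2 / (1 - r\<^sup>2)"
  have fac: "1 - r\<^sup>2 = (1 - r) * (1 + r)" by (simp add: power2_eq_square algebra_simps)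
  have xd: "x = (c * b - c * (r * b)) / (1 - r\<^sup>2)"
  proof -
    have "c * b - c * (r * b) = (1 - r) * (c * b)" by (simp add: algebra_simps)
    then show ?thesis using assms by (simp add: fac x_def)
  qed
  have "c\<^sup>2 * (1 + r) \<le> c\<^sup>2 * 2" using assms by (intro mult_left_mono) auto
  also have "c\<^sup>2 * 2 \<le> c * b" using assms by (simp add: power2_eq_square)
  finally have "c\<^sup>2 \<le> x" using assms by (simp add: x_def field_simps)
  then have "exp (2 * c\<^sup>2) \<le> exp (2 * x)" by simp
  with c2 have "3 < exp (2 * x)" by linarith
  moreover have "0 \<le> k" using assms r2 by (simp add: k_def)
  moreover have "2 * k < h"
  proof -
    have "2 * (2 * r * c\<^sup>2) < 2 * c * r * b"
      using assms by (simp add: power2_eq_square)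
    then show ?thesis
      using r2 by (simp add: k_def h_def divide_strict_right_mono)
  qed
  ultimately have less: "exp (x + k) + exp (k - x) < exp (x + h) + exp (- (x + h))"
    by (rule exp_mult_cosh_less)
  obtain K where K: "K > 0" and eq: "corner_sum c 0 b r = K *
      (exp ((r * c\<^sup>2 + (c * (0 - r * b) + c * (b - r * 0))) / (1 - r\<^sup>2))
       + exp ((r * c\<^sup>2 - (c * (0 - r * b) + c * (b - r * 0))) / (1 - r\<^sup>2))
       - (exp ((c * (0 - r * b) - c * (b - r * 0) - r * c\<^sup>2) / (1 - r\<^sup>2))
          + exp ((c * (b - r * 0) - c * (0 - r * b) - r * c\<^sup>2) / (1 - r\<^sup>2))))"
    using corner_sum_factor[OF r] .
  \<comment> \<open>These are \<open>B\<close>, \<open>- A\<close> and \<open>R\<close> divided by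
    \<open>1 - r\<^sup>2\<close>. In terms of \<open>x\<close>, \<open>h\<close>, \<open>k\<close>
    all four exponents carry the same shift \<open>- w\<close>, so \<open>exp w\<close> factors
    out.\<close>
  define p g w where "p = c * b / (1 - r\<^sup>2)" and "g = c * (r * b) / (1 - r\<^sup>2)"
    and "w = r * c\<^sup>2 / (1 - r\<^sup>2)"
  have xhk: "x = p - g" "h = 2 * g" "k = 2 * w"
    unfolding xd h_def k_def p_def g_def w_def by (simp_all add: diff_divide_distrib mult.assoc)
  have "(r * c\<^sup>2 + (c * (0 - r * b) + c * (b - r * 0))) / (1 - r\<^sup>2) = w + (p - g)"
    and "(r * c\<^sup>2 - (c * (0 - r * b) + c * (b - r * 0))) / (1 - r\<^sup>2) = w - (p - g)"
    and "(c * (0 - r * b) - c * (b - r * 0) - r * c\<^sup>2) / (1 - r\<^sup>2) = - g - p - w"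
    and "(c * (b - r * 0) - c * (0 - r * b) - r * c\<^sup>2) / (1 - r\<^sup>2) = p + g - w"
    unfolding p_def g_def w_def by (simp_all add: add_divide_distrib diff_divide_distrib)
  then have "(r * c\<^sup>2 + (c * (0 - r * b) + c * (b - r * 0))) / (1 - r\<^sup>2) = (x + k) - w"
    and "(r * c\<^sup>2 - (c * (0 - r * b) + c * (b - r * 0))) / (1 - r\<^sup>2) = (k - x) - w"
    and "(c * (0 - r * b) - c * (b - r * 0) - r * c\<^sup>2) / (1 - r\<^sup>2) = - (x + h) - w"
    and "(c * (b - r * 0) - c * (0 - r * b) - r * c\<^sup>2) / (1 - r\<^sup>2) = (x + h) - w"
    unfolding xhk by simp_all
  then have "corner_sum c 0 b r
      = K * ((exp (x + k) + exp (k - x) - (exp (x + h) + exp (- (x + h)))) / exp w)"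
    unfolding eq by (simp only: exp_diff add_divide_distrib diff_divide_distrib) simp
  then show ?thesis
    using K less by (simp add: mult_pos_neg divide_neg_pos)
qed

section \<open>Covariance of the tests\<close>

lemma covariance_one_minus_indicator:
  assumes "prob_space M" and [measurable]: "E \<in> sets M" "F \<in> sets M"
  shows "covariance M (\<lambda>\<omega>. 1 - indicator E \<omega>) (\<lambda>\<omega>. 1 - indicator F \<omega>)
    = measure M (E \<inter> F) - measure M E * measure M F"
proof -
  interpret prob_space M by fact
  have E: "(\<integral>\<omega>. 1 - indicator A \<omega> \<partial>M) = 1 - prob A" if "A \<in> sets M" for A
    using that by (simp add: Bochner_Integration.integral_diff prob_space less_top[symmetric])
  have "covariance M (\<lambda>\<omega>. 1 - indicator E \<omega>) (\<lambda>\<omega>. 1 - indicator F \<omega>)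
      = (\<integral>\<omega>. prob E * prob F - prob E * indicator F \<omega> - prob F * indicator E \<omega> + indicator (E \<inter> F) \<omega> \<partial>M)"
    unfolding covariance_def E[OF assms(2)] E[OF assms(3)]
    by (intro Bochner_Integration.integral_cong) (auto simp: indicator_def algebra_simps)
  also have "\<dots> = prob (E \<inter> F) - prob E * prob F"
    by (simp add: less_top[symmetric] prob_space algebra_simps)
  finally show ?thesis .
qed

text \<open>The entries of \<open>A ** transpose A\<close> are the inner products of the rows of
  \<open>A\<close>, so unit variances mean unit rows and the covariance is their inner
  product.\<close>

lemma multivariate_normal_unit_rows:
  fixes S :: "real ^ 'p ^ 'p"
  assumes Z: "multivariate_normal M Z m S" and unit: "S $ i $ i = 1" "S $ j $ j = 1"
  obtains A :: "real ^ 'p ^ 'p" where "distr M borel Z = distr std_normal_vector borel (\<lambda>x. m + A *v x)"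
    "norm (A $ i) = 1" "norm (A $ j) = 1" "S $ i $ j = A $ i \<bullet> A $ j"
proof -
  obtain A :: "real ^ 'p ^ 'p" where A: "A ** transpose A = S"
    "distr M borel Z = distr std_normal_vector borel (\<lambda>x. m + A *v x)"
    using Z unfolding multivariate_normal_def by auto
  have "S $ k $ l = A $ k \<bullet> A $ l" for k l
    unfolding A(1)[symmetric] by (simp add: matrix_matrix_mult_def transpose_def inner_vec_def)
  then show thesis using that[OF A(2)] unit by (simp add: norm_eq_1)
qed

text \<open>The factors \<open>e\<close> and \<open>d\<close> are signs. They keep the rows of the
  factor of \<open>S\<close> at unit length and change their inner product to
  \<open>q\<close>.\<close>

lemma distr_multivariate_normal_pair:
  fixes Z :: "'a \<Rightarrow> real ^ 'p"
  assumes Z: "multivariate_normal M Z m S" and unit: "S $ i $ i = 1" "S $ j $ j = 1"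
    and ij: "i \<noteq> j" and e: "e * e = 1" and d: "d * d = 1"
  defines "q \<equiv> e * d * S $ i $ j"
  shows "distr M (borel \<Otimes>\<^sub>M borel) (\<lambda>\<omega>. (e * Z \<omega> $ i, d * Z \<omega> $ j))
    = distr (std_normal_distribution \<Otimes>\<^sub>M std_normal_distribution) (borel \<Otimes>\<^sub>M borel)
        (\<lambda>(x, w). (e * m $ i + x, d * m $ j + (q * x + sqrt (1 - q\<^sup>2) * w)))"
proof -
  obtain A :: "real ^ 'p ^ 'p" where A: "distr M borel Z = distr std_normal_vector borel (\<lambda>x. m + A *v x)"
    "norm (A $ i) = 1" "norm (A $ j) = 1" "S $ i $ j = A $ i \<bullet> A $ j"
    using multivariate_normal_unit_rows[OF Z unit] .
  have [measurable]: "Z \<in> borel_measurable M"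
    using Z by (simp add: multivariate_normal_def)
  define u v where "u = e *\<^sub>R A $ i" and "v = d *\<^sub>R A $ j"
  have "\<bar>e\<bar> = 1" "\<bar>d\<bar> = 1"
    using e d by (metis abs_1 abs_mult abs_mult_self_eq mult_cancel_left1 abs_ge_zero abs_square_eq_1 power2_eq_square)+
  then have uv: "norm u = 1" "norm v = 1" "u \<bullet> v = q"
    using A by (simp_all add: u_def v_def q_def)
  define G where "G = (\<lambda>z :: real ^ 'p. (e * z $ i, d * z $ j))"
  define T where "T = (\<lambda>(x, y). (e * m $ i + x, d * m $ j + y))"
  define H where "H = (\<lambda>(x, w). (x, q * x + sqrt (1 - q\<^sup>2) * w))"
  have [measurable]: "G \<in> borel \<rightarrow>\<^sub>M borel \<Otimes>\<^sub>M borel" "T \<in> borel \<Otimes>\<^sub>M borel \<rightarrow>\<^sub>M borel \<Otimes>\<^sub>M borel"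
    "H \<in> borel \<Otimes>\<^sub>M borel \<rightarrow>\<^sub>M borel \<Otimes>\<^sub>M borel"
    unfolding G_def T_def H_def by measurable
  have [measurable]: "(\<lambda>x. m + A *v x) \<in> borel_measurable borel"
    by (intro borel_measurable_continuous_onI continuous_intros matrix_vector_mult_linear_continuous_on)
  have "distr M (borel \<Otimes>\<^sub>M borel) (\<lambda>\<omega>. G (Z \<omega>)) = distr (distr M borel Z) (borel \<Otimes>\<^sub>M borel) G"
    by (simp add: distr_distr o_def)
  also have "\<dots> = distr std_normal_vector (borel \<Otimes>\<^sub>M borel) (\<lambda>x. G (m + A *v x))"
    unfolding A(1) by (subst distr_distr) (auto simp: o_def)
  also have "(\<lambda>x. G (m + A *v x)) = (\<lambda>x. T (u \<bullet> x, v \<bullet> x))"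
    by (auto simp: G_def T_def u_def v_def matrix_vector_mul_component algebra_simps)
  also have "distr std_normal_vector (borel \<Otimes>\<^sub>M borel) (\<lambda>x. T (u \<bullet> x, v \<bullet> x))
      = distr (distr std_normal_vector (borel \<Otimes>\<^sub>M borel) (\<lambda>x. (u \<bullet> x, v \<bullet> x))) (borel \<Otimes>\<^sub>M borel) T"
    by (subst distr_distr) (auto simp: o_def)
  also have "distr std_normal_vector (borel \<Otimes>\<^sub>M borel) (\<lambda>x. (u \<bullet> x, v \<bullet> x))
      = distr (std_normal_distribution \<Otimes>\<^sub>M std_normal_distribution) (borel \<Otimes>\<^sub>M borel) H"
    unfolding distr_std_normal_vector_inner_pair[OF uv(1,2) ij] uv(3) H_def ..
  also have "distr \<dots> (borel \<Otimes>\<^sub>M borel) T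
      = distr (std_normal_distribution \<Otimes>\<^sub>M std_normal_distribution) (borel \<Otimes>\<^sub>M borel) (\<lambda>z. T (H z))"
    by (subst distr_distr) (auto simp: o_def)
  finally show ?thesis
    by (simp add: G_def T_def H_def case_prod_unfold)
qed

text \<open>Absolute values do not see the signs \<open>e\<close> and \<open>d\<close>, so the
  left-hand sides are free of them; this freedom later makes the means and the correlation
  nonnegative.\<close>

lemma multivariate_normal_band:
  fixes Z :: "'a \<Rightarrow> real ^ 'p"
  assumes Z: "multivariate_normal M Z m S" and unit: "S $ i $ i = 1" "S $ j $ j = 1"
    and ij: "i \<noteq> j" and e: "e * e = 1" and d: "d * d = 1"
  shows "measure M {\<omega> \<in> space M. \<bar>Z \<omega> $ i\<bar> \<le> c \<and> \<bar>Z \<omega> $ j\<bar> \<le> c}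
      = band_prob c (e * m $ i) (d * m $ j) (e * d * S $ i $ j)"
    and "measure M {\<omega> \<in> space M. \<bar>Z \<omega> $ i\<bar> \<le> c}
      = measure std_normal_distribution {x. \<bar>e * m $ i + x\<bar> \<le> c}"
proof -
  let ?N = std_normal_distribution
  interpret N: prob_space ?N by (rule prob_space_std_normal)
  interpret NN: pair_prob_space ?N ?N ..
  define q where "q = e * d * S $ i $ j"
  let ?X = "\<lambda>\<omega>. (e * Z \<omega> $ i, d * Z \<omega> $ j)"
  let ?Y = "\<lambda>(x, w). (e * m $ i + x, d * m $ j + (q * x + sqrt (1 - q\<^sup>2) * w))"
  have [measurable]: "Z \<in> borel_measurable M"
    using Z by (simp add: multivariate_normal_def)
  have [measurable]: "(\<lambda>\<omega>. Z \<omega> $ k) \<in> borel_measurable M" for k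
    by (rule measurable_compose[OF _ borel_measurable_continuous_onI]) (auto intro: continuous_intros)
  have X: "?X \<in> M \<rightarrow>\<^sub>M borel \<Otimes>\<^sub>M borel" by measurable
  have Y: "?Y \<in> ?N \<Otimes>\<^sub>M ?N \<rightarrow>\<^sub>M borel \<Otimes>\<^sub>M borel" by measurable
  have law: "measure M (?X -` Q \<inter> space M) = measure (?N \<Otimes>\<^sub>M ?N) (?Y -` Q)"
    if "closed Q" for Q
  proof -
    have Q: "Q \<in> sets (borel \<Otimes>\<^sub>M borel)"
      unfolding borel_prod using that by (rule borel_closed)
    show ?thesis
      using distr_multivariate_normal_pair[OF assms, folded q_def]
        measure_distr[OF X Q] measure_distr[OF Y Q] by (simp add: space_pair_measure)
  qed
  have ed: "\<bar>e * y\<bar> = \<bar>y\<bar>" "\<bar>d * y\<bar> = \<bar>y\<bar>" for y :: real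
    using e d by (auto simp: abs_mult square_eq_1_iff)
  have "closed {z :: real \<times> real. \<bar>fst z\<bar> \<le> c \<and> \<bar>snd z\<bar> \<le> c}"
    by (intro closed_Collect_conj closed_Collect_le continuous_intros)
  from law[OF this] show "measure M {\<omega> \<in> space M. \<bar>Z \<omega> $ i\<bar> \<le> c \<and> \<bar>Z \<omega> $ j\<bar> \<le> c}
      = band_prob c (e * m $ i) (d * m $ j) (e * d * S $ i $ j)"
    by (simp add: band_prob_def q_def vimage_def ed Int_def case_prod_unfold conj_commute)
  have "closed {z :: real \<times> real. \<bar>fst z\<bar> \<le> c}"
    by (intro closed_Collect_le continuous_intros)
  from law[OF this] have "measure M {\<omega> \<in> space M. \<bar>Z \<omega> $ i\<bar> \<le> c}
      = measure (?N \<Otimes>\<^sub>M ?N) ({x. \<bar>e * m $ i + x\<bar> \<le> c} \<times> UNIV)"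
    by (simp add: vimage_def ed Int_def case_prod_unfold conj_commute)
      (auto intro!: arg_cong[of _ _ "measure (?N \<Otimes>\<^sub>M ?N)"])
  also have "\<dots> = measure ?N {x. \<bar>e * m $ i + x\<bar> \<le> c} * measure ?N UNIV"
    by (simp add: measure_def N.emeasure_pair_measure_Times enn2real_mult)
  finally show "measure M {\<omega> \<in> space M. \<bar>Z \<omega> $ i\<bar> \<le> c}
      = measure ?N {x. \<bar>e * m $ i + x\<bar> \<le> c}"
    using N.prob_space by simp
qed

lemma covariance_two_sided_test:
  fixes Z :: "'a \<Rightarrow> real ^ 'p" and t :: real
  assumes Z: "multivariate_normal M Z m S" and unit: "S $ i $ i = 1" "S $ j $ j = 1"
    and ij: "i \<noteq> j" and e: "e * e = 1" and d: "d * d = 1"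
  defines "c \<equiv> \<bar>std_normal_quantile (t / 2)\<bar>"
  shows "covariance M (two_sided_test t Z i) (two_sided_test t Z j)
    = band_prob c (e * m $ i) (d * m $ j) (e * d * S $ i $ j) - band_prob c (e * m $ i) (d * m $ j) 0"
proof -
  have M: "prob_space M" and [measurable]: "Z \<in> borel_measurable M"
    using Z by (simp_all add: multivariate_normal_def)
  have [measurable]: "(\<lambda>\<omega>. Z \<omega> $ k) \<in> borel_measurable M" for k
    by (rule measurable_compose[OF _ borel_measurable_continuous_onI]) (auto intro: continuous_intros)
  define E where "E k = {\<omega> \<in> space M. \<bar>Z \<omega> $ k\<bar> \<le> c}" for k
  have [measurable]: "E k \<in> sets M" for k
    unfolding E_def by measurable
  have test: "two_sided_test t Z k \<omega> = 1 - indicator (E k) \<omega>" if "\<omega> \<in> space M" for k \<omega>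
    using that by (auto simp: two_sided_test_def E_def c_def indicator_def)
  have "(\<integral>\<omega>. two_sided_test t Z k \<omega> \<partial>M) = (\<integral>\<omega>. 1 - indicator (E k) \<omega> \<partial>M)" for k
    by (intro Bochner_Integration.integral_cong) (auto simp: test)
  then have "covariance M (two_sided_test t Z i) (two_sided_test t Z j)
      = covariance M (\<lambda>\<omega>. 1 - indicator (E i) \<omega>) (\<lambda>\<omega>. 1 - indicator (E j) \<omega>)"
    unfolding covariance_def by (intro Bochner_Integration.integral_cong) (auto simp: test)
  also have "\<dots> = measure M (E i \<inter> E j) - measure M (E i) * measure M (E j)"
    by (intro covariance_one_minus_indicator M) auto
  also have "E i \<inter> E j = {\<omega> \<in> space M. \<bar>Z \<omega> $ i\<bar> \<le> c \<and> \<bar>Z \<omega> $ j\<bar> \<le> c}"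
    by (auto simp: E_def)
  \<comment> \<open>The marginal probability for \<open>j\<close> comes from exchanging the roles of
    \<open>i\<close> and \<open>j\<close>; by \<open>band_prob_0\<close> the product of the
    marginals is the value at correlation \<open>0\<close>.\<close>
  finally show ?thesis
    using multivariate_normal_band[OF Z unit ij e d, of c]
      multivariate_normal_band(2)[OF Z unit(2,1) ij[symmetric] d e, of c]
    by (simp add: E_def band_prob_0)
qed

theorem theorem2:
  fixes M :: "'a measure"
    and Z :: "'a \<Rightarrow> real ^ 'p"
    and \<mu> :: "real ^ 'p"
    and S :: "real ^ 'p ^ 'p"
    and t :: real
    and i j :: 'p
  assumes t: "0 < t" "t < 1"
    and Z: "multivariate_normal M Z \<mu> S"
    and unit_var: "\<And>k. S $ k $ k = 1"
    and ij: "i \<noteq> j" "S $ i $ j \<noteq> 0"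
  shows
    "(i \<in> true_nulls \<mu> \<and> j \<in> true_nulls \<mu> \<longrightarrow>
        covariance M (two_sided_test t Z i) (two_sided_test t Z j) > 0) \<and>
     (i \<in> true_nulls \<mu> \<and> j \<in> false_nulls \<mu> \<and>
      \<bar>\<mu> $ j\<bar> > 2 * \<bar>std_normal_quantile (t / 2)\<bar> \<and>
      t < 2 * (1 - Phi (sqrt (ln 3 / 2))) \<longrightarrow>
        covariance M (two_sided_test t Z i) (two_sided_test t Z j) < 0) \<and>
     (i \<in> false_nulls \<mu> \<and> j \<in> false_nulls \<mu> \<and>
      \<bar>S $ i $ j\<bar> \<le> min \<bar>\<mu> $ i\<bar> \<bar>\<mu> $ j\<bar> /
                        (max \<bar>\<mu> $ i\<bar> \<bar>\<mu> $ j\<bar> + std_normal_quantile (t / 2)) \<and>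
      sgn (S $ i $ j) = sgn (\<mu> $ i * \<mu> $ j) \<longrightarrow>
        covariance M (two_sided_test t Z i) (two_sided_test t Z j) > 0)"
proof -
  define z where "z = std_normal_quantile (t / 2)"
  define c where "c = \<bar>z\<bar>"
  define r where "r = \<bar>S $ i $ j\<bar>"
  have r0: "0 < r" using ij by (simp add: r_def)
  have r1: "r \<le> 1"
  proof -
    obtain A :: "real ^ 'p ^ 'p" where "norm (A $ i) = 1" "norm (A $ j) = 1" "S $ i $ j = A $ i \<bullet> A $ j"
      using multivariate_normal_unit_rows[OF Z unit_var[of i] unit_var[of j]] .
    then show ?thesis
      using Cauchy_Schwarz_ineq2[of "A $ i" "A $ j"] by (simp add: r_def)
  qed
  have "Phi 0 = 1 / 2" using Phi_minus[of 0] by simp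
  then have z: "z < 0"
    unfolding z_def using t by (intro std_normal_quantile_less) auto
  then have c: "0 < c" "c = - z" by (auto simp: c_def)
  note cov = covariance_two_sided_test[OF Z unit_var unit_var ij(1), of _ _ t, folded z_def, folded c_def]
  have sgn_sq: "sgn y * sgn y = 1" if "y \<noteq> 0" for y :: real
    using that by (simp add: sgn_if)
  have r_sgn: "sgn (S $ i $ j) * S $ i $ j = r" by (simp add: r_def sgn_mult_self_eq mult_sgn_abs abs_sgn mult.commute)
  have a: "covariance M (two_sided_test t Z i) (two_sided_test t Z j) > 0"
    if "\<mu> $ i = 0" "\<mu> $ j = 0"
  proof -
    have "band_prob c 0 0 0 < band_prob c 0 0 r"
      using c r0 r1 by (intro band_prob_increasing corner_sum_pos) (auto simp: mult_nonneg_nonpos)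
    then show ?thesis
      using cov[of 1 "sgn (S $ i $ j)"] that sgn_sq[OF ij(2)] r_sgn by simp
  qed
  have b: "covariance M (two_sided_test t Z i) (two_sided_test t Z j) < 0"
    if "\<mu> $ i = 0" "\<mu> $ j \<noteq> 0" "2 * c < \<bar>\<mu> $ j\<bar>" "t < 2 * (1 - Phi (sqrt (ln 3 / 2)))"
  proof -
    \<comment> \<open>The bound on \<open>t\<close> says that \<open>t / 2\<close> lies below
      \<open>Phi (- sqrt (ln 3 / 2))\<close>; squaring then gives
      \<open>3 < exp (2 * c\<^sup>2)\<close>.\<close>
    have "z < - sqrt (ln 3 / 2)"
      unfolding z_def using t that(4) by (intro std_normal_quantile_less) (auto simp: Phi_minus)
    then have "sqrt (ln 3 / 2) < c" using c by simp
    then have "(sqrt (ln 3 / 2))\<^sup>2 < c\<^sup>2"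
      by (intro power_strict_mono) auto
    then have "ln 3 < 2 * c\<^sup>2" by simp
    then have "exp (ln 3) < exp (2 * c\<^sup>2)" by (simp only: exp_less_mono)
    then have "3 < exp (2 * c\<^sup>2)" by simp
    then have "band_prob c 0 \<bar>\<mu> $ j\<bar> r < band_prob c 0 \<bar>\<mu> $ j\<bar> 0"
      using c r0 r1 that(3) by (intro band_prob_decreasing corner_sum_neg) auto
    \<comment> \<open>The second sign makes the mean of \<open>j\<close> positive; the first, free
      because the mean of \<open>i\<close> is zero, makes the correlation equal to
      \<open>r\<close>.\<close>
    moreover have "sgn (S $ i $ j) * sgn (\<mu> $ j) * (sgn (S $ i $ j) * sgn (\<mu> $ j)) = 1"
      using sgn_sq[OF ij(2)] sgn_sq[OF that(2)] by (simp add: algebra_simps)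
    moreover have "sgn (\<mu> $ j) * \<mu> $ j = \<bar>\<mu> $ j\<bar>" by (simp add: sgn_if)
    moreover have "sgn (S $ i $ j) * sgn (\<mu> $ j) * sgn (\<mu> $ j) * S $ i $ j = r"
      using sgn_sq[OF that(2)] r_sgn by (simp add: mult.assoc)
    ultimately show ?thesis
      using cov[of "sgn (S $ i $ j) * sgn (\<mu> $ j)" "sgn (\<mu> $ j)"] that(1) sgn_sq[OF that(2)] by simp
  qed
  have c: "covariance M (two_sided_test t Z i) (two_sided_test t Z j) > 0"
    if nz: "\<mu> $ i \<noteq> 0" "\<mu> $ j \<noteq> 0"
      and le: "r \<le> min \<bar>\<mu> $ i\<bar> \<bar>\<mu> $ j\<bar> / (max \<bar>\<mu> $ i\<bar> \<bar>\<mu> $ j\<bar> + z)"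
      and sg: "sgn (S $ i $ j) = sgn (\<mu> $ i * \<mu> $ j)"
  proof -
    let ?a = "\<bar>\<mu> $ i\<bar>" and ?b = "\<bar>\<mu> $ j\<bar>"
    let ?den = "max ?a ?b - c"
    have min0: "0 < min ?a ?b" using nz by simp
    \<comment> \<open>The hypothesis forces this: a nonpositive denominator, zero included, would
      make the quotient at most \<open>0\<close>, against \<open>0 < r\<close>.\<close>
    have den: "0 < ?den"
    proof (rule ccontr)
      assume "\<not> 0 < ?den"
      then have "min ?a ?b / ?den \<le> 0"
        using min0 by (intro divide_nonneg_nonpos) auto
      with le r0 c show False by simp
    qed
    have rd: "r * ?den \<le> min ?a ?b"
      using le den c by (simp add: pos_le_divide_eq)
    \<comment> \<open>As \<open>y - c\<close> may be negative, \<open>y\<close> is first raised to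
      the maximum, and only then \<open>q\<close> to \<open>r\<close>.\<close>
    have key: "q * (y - c) \<le> min ?a ?b" if "0 < q" "q < r" "y \<le> max ?a ?b" for q y
    proof -
      have "q * (y - c) \<le> q * ?den" using that by (intro mult_left_mono) auto
      also have "\<dots> \<le> r * ?den" using that den by (intro mult_right_mono) auto
      finally show ?thesis using rd by linarith
    qed
    have "band_prob c ?a ?b 0 < band_prob c ?a ?b r"
    proof (rule band_prob_increasing)
      fix q assume q: "0 < q" "q < r"
      have "q * (?b - c) \<le> ?a" "q * (?a - c) \<le> ?b"
        using key[OF q, of ?b] key[OF q, of ?a] by auto
      then show "0 < corner_sum c ?a ?b q"
        using q r1 c by (intro corner_sum_pos) auto
    qed (use c r0 r1 in auto)
    moreover have "sgn (\<mu> $ i) * \<mu> $ i = ?a" "sgn (\<mu> $ j) * \<mu> $ j = ?b"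
      by (simp_all add: sgn_if)
    \<comment> \<open>By the sign hypothesis, the flips that make both means positive also make the
      correlation positive.\<close>
    moreover have "sgn (\<mu> $ i) * sgn (\<mu> $ j) * S $ i $ j = r"
      using sg r_sgn by (simp add: sgn_mult)
    ultimately show ?thesis
      using cov[of "sgn (\<mu> $ i)" "sgn (\<mu> $ j)"] sgn_sq nz by simp
  qed
  show ?thesis
    using a b c by (simp add: true_nulls_def false_nulls_def z_def c_def r_def)
qed

end
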